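(* Let $2\le p<\infty$. Then there exist positive constants $c_3=c_3(p)$ and $c_4=c_4(p)$, depending only on $p$, such that for every natural $n\ge 2$ the following estimates for the constant $d_n$ hold: $$\left(\frac{p}{p-1}\right)^p-\frac{c_3}{\ln^2 n}\le d_n\le\left(\frac{p}{p-1}\right)^p-\frac{c_4}{\ln^2 n}.$$ Moreover, the sequence $$a_k^\ast=\int_k^{k+1}f^*(x)\,dx,\qquad k=1,2,\dots,n,$$ where $$f^*(x)=\frac{1}{x^{1/p}}\left(\frac{\alpha p}{p-1}\cos(\alpha\ln x)+\sin(\alpha\ln x)\right),\qquad 1\le x\le n+1,$$ and $\alpha$ is the only solution of the equation $$\tan(\alpha\ln(n+1))+\frac{\alpha p}{p-1}=0$$ in the interval $\left(\frac{\pi}{2\ln(n+1)},\frac{\pi}{\ln(n+1)}\right)$, is an "almost extremal" sequence in the sense that $$\sum_{k=1}^{n}\left(\frac{1}{k}\sum_{j=1}^{k}a_j^\ast\right)^p\ge\left(\left(\frac{p}{p-1}\right)^p-\frac{c_3}{\ln^2 n}\right)\sum_{k=1}^{n}[a_k^\ast]^p.$$ Also, letting $n\to\infty$, for the constant $c_3$ the following estimate holds: $$c_3\le\left(\frac{p}{p-1}\right)^{p+1}p\pi^2,$$ which is the exact constant for $p=2$.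
   Context: For $p>1$ and a natural number $n$, $d_n$ denotes the smallest possible constant in the finite Hardy inequality $$\sum_{k=1}^{n}\left(\frac{1}{k}\sum_{j=1}^{k}a_j\right)^p\le d_n\sum_{k=1}^{n}a_k^p,\qquad a_k\ge 0,\ k=1,2,\dots,n,$$ that is, the smallest constant for which the inequality holds for all such $a_1,\dots,a_n$. *)

theory Defs
  imports "HOL-Analysis.Analysis"
begin

text \<open>All bases of \<open>powr\<close> below are nonnegative, so \<open>x powr p\<close> is the usual real
  power (with \<open>0 powr p = 0\<close>).\<close>

definition finite_hardy :: "real \<Rightarrow> nat \<Rightarrow> (nat \<Rightarrow> real) \<Rightarrow> real \<Rightarrow> bool" where
  "finite_hardy p n a C \<longleftrightarrow>
     (\<Sum>k=1..n. ((1 / real k) * (\<Sum>j=1..k. a j)) powr p) \<le> C * (\<Sum>k=1..n. a k powr p)"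

definition hardy_const :: "real \<Rightarrow> nat \<Rightarrow> real" where
  "hardy_const p n =
     (LEAST C. \<forall>a. (\<forall>k\<in>{1..n}. 0 \<le> a k) \<longrightarrow> finite_hardy p n a C)"

text \<open>The least constant exists, so the \<open>LEAST\<close> above is not a junk value.\<close>

lemma hardy_const_least:
  assumes "p > 0" and "n \<ge> 1"
  shows "\<forall>a. (\<forall>k\<in>{1..n}. 0 \<le> a k) \<longrightarrow> finite_hardy p n a (hardy_const p n)"
    and "(\<forall>a. (\<forall>k\<in>{1..n}. 0 \<le> a k) \<longrightarrow> finite_hardy p n a C) \<Longrightarrow> hardy_const p n \<le> C"
proof -
  define S where "S = {C. \<forall>a. (\<forall>k\<in>{1..n}. 0 \<le> a k) \<longrightarrow> finite_hardy p n a C}"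
  have "real n \<in> S"
    unfolding S_def finite_hardy_def
  proof (safe)
    fix a :: "nat \<Rightarrow> real" assume a: "\<forall>k\<in>{1..n}. 0 \<le> a k"
    define M where "M = Max (a ` {1..n})"
    have M: "a k \<le> M" if "k \<in> {1..n}" for k
      unfolding M_def using that by (intro Max_ge) auto
    have "M \<in> a ` {1..n}" unfolding M_def using assms by (intro Max_in) auto
    then obtain m where m: "m \<in> {1..n}" "M = a m" by auto
    have "((1 / real k) * (\<Sum>j=1..k. a j)) powr p \<le> (\<Sum>k=1..n. a k powr p)" if k: "k \<in> {1..n}" for k
    proof -
      have "(\<Sum>j=1..k. a j) \<le> (\<Sum>j=1..k. M)" using k M by (intro sum_mono) auto
      hence "(1 / real k) * (\<Sum>j=1..k. a j) \<le> M" using k by (simp add: field_simps)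
      moreover have "0 \<le> (1 / real k) * (\<Sum>j=1..k. a j)"
        using k a by (intro mult_nonneg_nonneg sum_nonneg) auto
      ultimately have "((1 / real k) * (\<Sum>j=1..k. a j)) powr p \<le> a m powr p"
        using assms m by (intro powr_mono2) auto
      also have "\<dots> \<le> (\<Sum>k=1..n. a k powr p)" using m by (intro member_le_sum) auto
      finally show ?thesis .
    qed
    hence "(\<Sum>k=1..n. ((1 / real k) * (\<Sum>j=1..k. a j)) powr p) \<le> (\<Sum>k=1..n. (\<Sum>k=1..n. a k powr p))"
      by (rule sum_mono)
    thus "(\<Sum>k=1..n. ((1 / real k) * (\<Sum>j=1..k. a j)) powr p) \<le> real n * (\<Sum>k=1..n. a k powr p)"
      by simp
  qed
  have pos: "0 < (\<Sum>k=1..n. (1::real) powr p)" using assms by simp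
  have nn: "0 \<le> C" if "C \<in> S" for C
  proof -
    have "finite_hardy p n (\<lambda>_. 1) C" using that unfolding S_def by simp
    hence "0 \<le> C * (\<Sum>k=1..n. (1::real) powr p)"
      unfolding finite_hardy_def by (rule order_trans[rotated]) (auto intro!: sum_nonneg)
    thus ?thesis using pos assms by (simp add: zero_le_mult_iff)
  qed
  have bdd: "bdd_below S" using nn by (rule bdd_belowI)
  have "\<forall>a. (\<forall>k\<in>{1..n}. 0 \<le> a k) \<longrightarrow> finite_hardy p n a (Inf S)"
  proof (intro allI impI)
    fix a :: "nat \<Rightarrow> real" assume a: "\<forall>k\<in>{1..n}. 0 \<le> a k"
    let ?L = "\<Sum>k=1..n. ((1 / real k) * (\<Sum>j=1..k. a j)) powr p"
    let ?R = "\<Sum>k=1..n. a k powr p"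
    have le: "?L \<le> C * ?R" if "C \<in> S" for C
      using that a unfolding S_def finite_hardy_def by simp
    have "0 \<le> ?R" by (intro sum_nonneg) auto
    then consider "?R = 0" | "?R > 0" by linarith
    thus "finite_hardy p n a (Inf S)"
    proof cases
      case 1
      thus ?thesis using le[OF \<open>real n \<in> S\<close>] unfolding finite_hardy_def by simp
    next
      case 2
      have "?L / ?R \<le> Inf S"
        using \<open>real n \<in> S\<close> le 2 by (intro cInf_greatest) (auto simp: pos_divide_le_eq)
      thus ?thesis using 2 unfolding finite_hardy_def by (simp add: pos_divide_le_eq)
    qed
  qed
  then have "Inf S \<in> S"
    by (subst (2) S_def) (rule CollectI)
  moreover have "hardy_const p n = Inf S"
    unfolding hardy_const_def
  proof (rule Least_equality)
    show "\<forall>a. (\<forall>k\<in>{1..n}. 0 \<le> a k) \<longrightarrow> finite_hardy p n a (Inf S)" by fact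
    show "Inf S \<le> C" if "\<forall>a. (\<forall>k\<in>{1..n}. 0 \<le> a k) \<longrightarrow> finite_hardy p n a C" for C
      by (rule cInf_lower[OF _ bdd]) (use that in \<open>simp add: S_def\<close>)
  qed
  ultimately have *: "hardy_const p n \<in> S" "\<And>C. C \<in> S \<Longrightarrow> hardy_const p n \<le> C"
    using cInf_lower[OF _ bdd] by auto
  show "\<forall>a. (\<forall>k\<in>{1..n}. 0 \<le> a k) \<longrightarrow> finite_hardy p n a (hardy_const p n)"
    using *(1) unfolding S_def by blast
  show "hardy_const p n \<le> C"
    if "\<forall>a. (\<forall>k\<in>{1..n}. 0 \<le> a k) \<longrightarrow> finite_hardy p n a C"
    using *(2) that unfolding S_def by blast
qed

definition alpha_eq :: "real \<Rightarrow> nat \<Rightarrow> real \<Rightarrow> bool" where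
  "alpha_eq p n \<alpha> \<longleftrightarrow>
     \<alpha> \<in> {pi / (2 * ln (real n + 1)) <..< pi / ln (real n + 1)} \<and>
     tan (\<alpha> * ln (real n + 1)) + \<alpha> * p / (p - 1) = 0"

definition fstar :: "real \<Rightarrow> real \<Rightarrow> real \<Rightarrow> real" where
  "fstar p \<alpha> x =
     1 / x powr (1 / p) * (\<alpha> * p / (p - 1) * cos (\<alpha> * ln x) + sin (\<alpha> * ln x))"

definition astar :: "real \<Rightarrow> real \<Rightarrow> nat \<Rightarrow> real" where
  "astar p \<alpha> k = integral {real k .. real k + 1} (fstar p \<alpha>)"

end

theory Submission
  imports Defs "HOL-Real_Asymp.Real_Asymp"
begin

text \<open>
  Write \<open>q = p / (p - 1)\<close>. The constant \<open>q powr p\<close> is that of Hardy's inequality on the half line,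
  where it is not attained: the \<open>p\<close>-th power of the would-be extremal \<open>x powr (- 1 / p)\<close> just
  fails to be integrable. In the variable \<open>ln x\<close> the finite problem lives on an interval of length about
  \<open>ln n\<close>, and the deficit of order \<open>1 / (ln n)\<^sup>2\<close> has the size of the first eigenvalue of that interval.

  For the lower estimate the integral of \<open>fstar\<close> from \<open>1\<close> to \<open>x\<close> is
  \<open>F x = q * x powr (1 - 1 / p) * sin (\<alpha> * ln x)\<close>, and the equation for \<open>\<alpha>\<close> says that
  \<open>fstar x = x powr (- 1 / p) * sin (\<alpha> * ln x + \<phi>) / cos \<phi>\<close> with \<open>\<phi> = pi - \<alpha> * ln (n + 1)\<close>.
  Monotonicity of \<open>F\<close> and Jensen's inequality reduce the claim for the sequence \<open>astar\<close> to
  integrals over \<open>{1..n + 1}\<close>. With \<open>\<alpha> * ln x\<close> and \<open>\<alpha> * ln x + \<phi>\<close> as new variables these are integrals of \<open>sin powr p\<close>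
  over \<open>{0..pi - \<phi>}\<close> and over \<open>{\<phi>..pi}\<close>, which are equal by symmetry, so the Hardy quotient of
  \<open>astar\<close> is at least \<open>(q * cos \<phi>) powr p\<close> (\<open>astar_hardy_ratio\<close>). As \<open>tan \<phi> = \<alpha> * q\<close> and
  \<open>\<alpha> < pi / ln n\<close>, this differs from \<open>q powr p\<close> by at most a constant over \<open>(ln n)\<^sup>2\<close>.

  For the upper estimate, any positive supersolution of the Euler--Lagrange equation bounds the
  constant (\<open>hardy_const_le_of_supersolution\<close>). A supersolution of the continuous equation
  becomes one of the discrete equation when it is sampled at half-integers, since by convexity
  all errors have the favourable sign (\<open>hardy_const_le_of_convex_profile\<close>). The profile used is the
  pure power times a slowly varying factor, \<open>x powr (1 - 1 / p) * sin (\<alpha> * ln x + \<phi>) powr m\<close>.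
  For small \<open>\<alpha>\<close> it inherits convexity from the pure power (\<open>slope_window\<close>), and a Riccati
  inequality (\<open>riccati_lower_bound\<close>) shows that it is a supersolution with a gain proportional
  to \<open>\<alpha>\<^sup>2\<close>. The phase may run through almost all of \<open>{0..pi}\<close>, so \<open>\<alpha>\<close> can be taken asymptotic to
  \<open>pi / ln n\<close>. For \<open>p = 2\<close> the equation is linear, the profile with \<open>m = 1\<close> solves it, nothing is
  lost, and the two estimates agree to leading order. Small \<open>n\<close> are covered because the
  constant increases with \<open>n\<close>.
\<close>

section \<open>Elementary inequalities\<close>

lemma increment_mono:
  fixes g h :: "real \<Rightarrow> real"
  assumes "a \<le> b"
    and "\<And>x. a \<le> x \<Longrightarrow> x \<le> b \<Longrightarrow> (g has_real_derivative g' x) (at x)"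
    and "\<And>x. a \<le> x \<Longrightarrow> x \<le> b \<Longrightarrow> (h has_real_derivative h' x) (at x)"
    and "\<And>x. a \<le> x \<Longrightarrow> x \<le> b \<Longrightarrow> g' x \<le> h' x"
  shows "g b - g a \<le> h b - h a"
proof -
  have "(\<lambda>x. h x - g x) a \<le> (\<lambda>x. h x - g x) b"
  proof (rule DERIV_nonneg_imp_nondecreasing[OF assms(1)])
    fix x assume x: "a \<le> x" "x \<le> b"
    have "((\<lambda>x. h x - g x) has_real_derivative h' x - g' x) (at x)"
      by (intro DERIV_diff assms(2,3) x)
    thus "\<exists>y. ((\<lambda>x. h x - g x) has_real_derivative y) (at x) \<and> 0 \<le> y"
      using assms(4)[OF x] by force
  qed
  thus ?thesis by simp
qed

lemma powr_ge_tangent: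
  fixes x M p :: real
  assumes "1 \<le> p" "0 \<le> x" "0 \<le> M"
  shows "M powr p + p * M powr (p - 1) * (x - M) \<le> x powr p"
proof (cases "M = 0")
  case False
  hence M: "0 < M" using assms by simp
  show ?thesis
  proof (cases "x = 0")
    case True
    have "M powr p = M powr (p - 1) * M"
      using powr_mult_base[of M "p - 1"] M by (simp add: mult.commute)
    hence "M powr p + p * M powr (p - 1) * (x - M) = (1 - p) * M powr p"
      using True by (simp add: algebra_simps)
    also have "\<dots> \<le> 0" using assms by (intro mult_nonpos_nonneg) auto
    finally show ?thesis by (simp add: True)
  next
    case False
    hence "0 < x" using assms by simp
    hence "(p * M powr (p - 1)) * (x - M) \<le> x powr p - M powr p"
      using M by (intro convex_on_imp_above_tangent[OF powr_convex[OF assms(1)]])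
        (auto intro!: derivative_eq_intros simp: interior_open)
    thus ?thesis by simp
  qed
qed (use assms in auto)

text \<open>Jensen's inequality on an interval of length one, with \<open>T\<close> in place of the integral of
  \<open>f powr p\<close>: the tangent of \<open>x powr p\<close> at the mean value \<open>M\<close> of \<open>f\<close> lies below
  \<open>x powr p\<close>, and its linear part integrates to zero.\<close>

lemma powr_unit_increment_le:
  fixes F f T :: "real \<Rightarrow> real"
  assumes p: "1 \<le> p"
    and dF: "\<And>x. a \<le> x \<Longrightarrow> x \<le> a + 1 \<Longrightarrow> (F has_real_derivative f x) (at x)"
    and dT: "\<And>x. a \<le> x \<Longrightarrow> x \<le> a + 1 \<Longrightarrow> (T has_real_derivative f x powr p) (at x)"
    and f: "\<And>x. a \<le> x \<Longrightarrow> x \<le> a + 1 \<Longrightarrow> 0 \<le> f x"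
  shows "(F (a + 1) - F a) powr p \<le> T (a + 1) - T a"
proof -
  define M where "M = F (a + 1) - F a"
  have "(\<lambda>x. 0) (a + 1) - (\<lambda>x. 0) a \<le> F (a + 1) - F a"
    by (rule increment_mono[where g' = "\<lambda>_. 0"]) (use dF f in auto)
  hence M: "0 \<le> M" by (simp add: M_def)
  let ?l = "\<lambda>x. M powr p * x + p * M powr (p - 1) * (F x - M * x)"
  have "?l (a + 1) - ?l a \<le> T (a + 1) - T a"
  proof (rule increment_mono)
    fix x assume x: "a \<le> x" "x \<le> a + 1"
    show "(?l has_real_derivative M powr p + p * M powr (p - 1) * (f x - M)) (at x)"
      by (auto intro!: derivative_eq_intros dF x)
    show "(T has_real_derivative f x powr p) (at x)" by (rule dT[OF x])
    show "M powr p + p * M powr (p - 1) * (f x - M) \<le> f x powr p"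
      by (intro powr_ge_tangent p M f x)
  qed simp
  also have "?l (a + 1) - ?l a = M powr p"
    by (simp add: M_def algebra_simps)
  finally show ?thesis by (simp add: M_def)
qed

text \<open>The Hermite--Hadamard inequality: the integral of a convex function is at least the length of the
  interval times the value at the midpoint, because the tangent there lies below the function.
  The increment of \<open>g\<close> stands for the integral.\<close>

lemma midpoint_increment:
  fixes g w :: "real \<Rightarrow> real"
  assumes h: "0 < h" and conv: "convex_on {c - h..c + h} w"
    and dw: "(w has_real_derivative k) (at c)"
    and dg: "\<And>x. x \<in> {c - h..c + h} \<Longrightarrow> (g has_real_derivative g' x) (at x)"
    and le: "\<And>x. x \<in> {c - h..c + h} \<Longrightarrow> w x \<le> g' x"
  shows "2 * h * w c \<le> g (c + h) - g (c - h)"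
proof -
  have tangent: "w c + k * (x - c) \<le> w x" if "x \<in> {c - h..c + h}" for x
  proof -
    have "k * (x - c) \<le> w x - w c"
      using h that by (intro convex_on_imp_above_tangent[OF conv])
        (auto intro: has_field_derivative_at_within dw)
    thus ?thesis by simp
  qed
  let ?l = "\<lambda>x. w c * x + k * (x - c)\<^sup>2 / 2"
  have "?l (c + h) - ?l (c - h) \<le> g (c + h) - g (c - h)"
  proof (rule increment_mono)
    show "(?l has_real_derivative w c + k * (x - c)) (at x)" for x
      by (auto intro!: derivative_eq_intros)
    show "(g has_real_derivative g' x) (at x)" if "c - h \<le> x" "x \<le> c + h" for x
      using dg that by auto
    show "w c + k * (x - c) \<le> g' x" if "c - h \<le> x" "x \<le> c + h" for x
      using tangent[of x] le[of x] that by auto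
  qed (use h in simp)
  thus ?thesis by (simp add: algebra_simps)
qed

text \<open>Hoelder's inequality for the factorisation
  \<open>a i = v i powr ((p - 1) / p) * (a i * v i powr ((1 - p) / p))\<close>. Equivalently, it is Jensen's
  inequality for the mean of \<open>a i / v i\<close> with weights \<open>v i\<close>, and is proved as such.\<close>

lemma powr_sum_le_weighted:
  fixes a v :: "'i \<Rightarrow> real" and p :: real
  assumes "1 \<le> p" "finite I" "I \<noteq> {}"
    and a: "\<And>i. i \<in> I \<Longrightarrow> 0 \<le> a i" and v: "\<And>i. i \<in> I \<Longrightarrow> 0 < v i"
  shows "sum a I powr p \<le> sum v I powr (p - 1) * (\<Sum>i\<in>I. a i powr p * v i powr (1 - p))"
proof -
  define V where "V = sum v I"
  define M where "M = sum a I / V"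
  have V: "0 < V" unfolding V_def using assms by (intro sum_pos) auto
  have M: "0 \<le> M" unfolding M_def using V a by (intro divide_nonneg_pos sum_nonneg) auto
  have "V * M powr p = (\<Sum>i\<in>I. v i * M powr p + p * M powr (p - 1) * (a i - v i * M))"
  proof -
    have "(\<Sum>i\<in>I. v i * M powr p + p * M powr (p - 1) * (a i - v i * M))
        = V * M powr p + p * M powr (p - 1) * (sum a I - V * M)"
      by (simp add: sum.distrib sum_subtractf V_def flip: sum_distrib_left sum_distrib_right)
    thus ?thesis using V by (simp add: M_def)
  qed
  also have "\<dots> \<le> (\<Sum>i\<in>I. a i powr p * v i powr (1 - p))"
  proof (rule sum_mono)
    fix i assume i: "i \<in> I"
    have "v i * (M powr p + p * M powr (p - 1) * (a i / v i - M)) \<le> v i * (a i / v i) powr p"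
      using a[OF i] v[OF i] assms(1) M
      by (intro mult_left_mono powr_ge_tangent) (auto intro: divide_nonneg_pos)
    also have "v i * (a i / v i) powr p = a i powr p * v i powr (1 - p)"
      using a[OF i] v[OF i] by (simp add: powr_divide powr_diff)
    also have "v i * (M powr p + p * M powr (p - 1) * (a i / v i - M)) =
        v i * M powr p + p * M powr (p - 1) * (a i - v i * M)"
      using v[OF i] by (simp add: field_simps)
    finally show "v i * M powr p + p * M powr (p - 1) * (a i - v i * M) \<le> a i powr p * v i powr (1 - p)" .
  qed
  finally have *: "V * M powr p \<le> (\<Sum>i\<in>I. a i powr p * v i powr (1 - p))" .
  have "sum a I powr p = (M * V) powr p" using V by (simp add: M_def)
  also have "\<dots> = V powr (p - 1) * (V * M powr p)"
    using V M by (simp add: powr_mult powr_diff)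
  also have "\<dots> \<le> V powr (p - 1) * (\<Sum>i\<in>I. a i powr p * v i powr (1 - p))"
    by (intro mult_left_mono *) auto
  finally show ?thesis by (simp add: V_def)
qed

section \<open>The almost extremal sequence\<close>

text \<open>Multiplied by the cosine, the equation has no pole, and the intermediate value theorem applies
  on the closed interval. The tangent and the linear term both increase, hence uniqueness.\<close>

lemma alpha_eq_unique_solution:
  assumes p: "1 < p" and n: "1 \<le> n"
  shows "\<exists>!\<alpha>. alpha_eq p n \<alpha>"
proof -
  define L where "L = ln (real n + 1)"
  define G where "G \<alpha> = \<alpha> * p / (p - 1) * cos (\<alpha> * L) + sin (\<alpha> * L)" for \<alpha>
  have L: "0 < L" using n by (simp add: L_def)
  have ivl: "pi / 2 < \<alpha> * L" "\<alpha> * L < pi" "0 < \<alpha>"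
    if "\<alpha> \<in> {pi / (2 * L)<..<pi / L}" for \<alpha>
  proof -
    show "pi / 2 < \<alpha> * L" "\<alpha> * L < pi" using that L by (auto simp: field_simps)
    have "0 < pi / (2 * L)" using L by simp
    thus "0 < \<alpha>" using that by auto
  qed
  have "\<exists>\<alpha>. pi / (2 * L) \<le> \<alpha> \<and> \<alpha> \<le> pi / L \<and> G \<alpha> = 0"
  proof (rule IVT2')
    show "G (pi / L) \<le> 0" using L p by (simp add: G_def)
    show "0 \<le> G (pi / (2 * L))" using L p by (simp add: G_def)
    show "continuous_on {pi / (2 * L)..pi / L} G"
      unfolding G_def by (intro continuous_intros) (use p in auto)
    show "pi / (2 * L) \<le> pi / L" using L by (simp add: field_simps)
  qed
  then obtain \<alpha> where \<alpha>: "pi / (2 * L) \<le> \<alpha>" "\<alpha> \<le> pi / L" "G \<alpha> = 0" by auto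
  have "\<alpha> \<noteq> pi / (2 * L)" "\<alpha> \<noteq> pi / L" using \<alpha>(3) L p by (auto simp: G_def)
  hence \<alpha>_ivl: "\<alpha> \<in> {pi / (2 * L)<..<pi / L}" using \<alpha> by auto
  have "cos (\<alpha> * L) < 0" using cos_lt_zero_pi[of "\<alpha> * L"] ivl[OF \<alpha>_ivl] by simp
  hence "tan (\<alpha> * L) + \<alpha> * p / (p - 1) = G \<alpha> / cos (\<alpha> * L)"
    by (simp add: G_def tan_def add_divide_distrib)
  hence ex: "alpha_eq p n \<alpha>" using \<alpha>_ivl \<alpha>(3) by (simp add: alpha_eq_def L_def)
  have tan_less: "tan (\<beta> * L) < tan (\<gamma> * L)"
    if "\<beta> < \<gamma>" "\<beta> \<in> {pi / (2 * L)<..<pi / L}" "\<gamma> \<in> {pi / (2 * L)<..<pi / L}" for \<beta> \<gamma>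
  proof -
    have "tan (\<beta> * L - pi) < tan (\<gamma> * L - pi)"
      using that ivl[OF that(2)] ivl[OF that(3)] L by (intro tan_monotone) auto
    thus ?thesis using tan_periodic_pi[of "\<beta> * L - pi"] tan_periodic_pi[of "\<gamma> * L - pi"] by simp
  qed
  have no_pair: False if "\<beta> < \<gamma>" "alpha_eq p n \<beta>" "alpha_eq p n \<gamma>" for \<beta> \<gamma>
  proof -
    have "\<beta> * (p / (p - 1)) < \<gamma> * (p / (p - 1))"
      using that(1) p by (intro mult_strict_right_mono) auto
    thus False using tan_less[OF that(1)] that(2,3) unfolding alpha_eq_def L_def by fastforce
  qed
  show ?thesis
  proof (rule ex1I)
    show "alpha_eq p n \<alpha>" by (fact ex)
    fix \<beta> assume "alpha_eq p n \<beta>"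
    thus "\<beta> = \<alpha>" using no_pair ex by (cases \<beta> \<alpha> rule: linorder_cases) auto
  qed
qed

text \<open>With \<open>F x = q * x powr (1 - 1 / p) * sin (\<alpha> * ln x)\<close>, \<open>q = p / (p - 1)\<close>, the sums of \<open>astar\<close>
  are the values \<open>F (k + 1)\<close>. As \<open>F\<close> increases, the left-hand sum of Hardy's inequality is at
  least the integral of \<open>(F x / x) powr p\<close> over \<open>{1..n + 1}\<close>, and by Jensen the right-hand sum is
  at most that of \<open>fstar powr p\<close>. The substitutions \<open>t = \<alpha> * ln x\<close>
  in the first and \<open>t = \<alpha> * ln x + \<phi>\<close>, \<open>tan \<phi> = b\<close>, in the second turn both into integrals of
  \<open>sin t powr p\<close>, over intervals that are mirror images of each other under \<open>t \<mapsto> pi - t\<close>. The integrals cancel, and only the amplitudes remain.\<close>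

lemma astar_hardy_ratio:
  fixes p \<alpha> :: real
  assumes p: "1 < p" and n: "1 \<le> n" and alpha: "alpha_eq p n \<alpha>"
  defines "b \<equiv> \<alpha> * p / (p - 1)"
  shows "\<forall>k\<in>{1..n}. 0 \<le> astar p \<alpha> k"
    and "0 < (\<Sum>k=1..n. astar p \<alpha> k powr p)"
    and "(p / (p - 1)) powr p * (1 + b\<^sup>2) powr (- (p / 2)) * (\<Sum>k=1..n. astar p \<alpha> k powr p)
      \<le> (\<Sum>k=1..n. ((1 / real k) * (\<Sum>j=1..k. astar p \<alpha> j)) powr p)"
proof -
  define q where "q = p / (p - 1)"
  define L where "L = ln (real n + 1)"
  define \<phi> where "\<phi> = pi - \<alpha> * L"
  have q: "0 < q" using p by (simp add: q_def)
  have L: "0 < L" using n by (simp add: L_def)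
  have \<alpha>L: "pi / 2 < \<alpha> * L" "\<alpha> * L < pi" and \<alpha>: "0 < \<alpha>"
  proof -
    have "pi / (2 * L) < \<alpha>" "\<alpha> < pi / L"
      using alpha by (simp_all add: alpha_eq_def L_def)
    thus "pi / 2 < \<alpha> * L" "\<alpha> * L < pi" using L by (auto simp: field_simps)
    have "0 < pi / (2 * L)" using L by simp
    also have "\<dots> < \<alpha>" using alpha by (simp add: alpha_eq_def L_def)
    finally show "0 < \<alpha>" .
  qed
  have \<phi>: "0 < \<phi>" "\<phi> < pi / 2" using \<alpha>L by (auto simp: \<phi>_def)
  have cos_\<phi>: "0 < cos \<phi>" using \<phi> by (intro cos_gt_zero) auto
  have "tan \<phi> = - tan (\<alpha> * L)" unfolding \<phi>_def by (simp add: tan_def)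
  also have "\<dots> = b" using alpha by (simp add: alpha_eq_def L_def b_def)
  finally have tan_\<phi>: "tan \<phi> = b" .
  have angle: "0 \<le> \<alpha> * ln x" "\<alpha> * ln x + \<phi> \<le> pi" if "1 \<le> x" "x \<le> real n + 1" for x
  proof -
    show "0 \<le> \<alpha> * ln x" using that \<alpha> by simp
    have "\<alpha> * ln x \<le> \<alpha> * L" unfolding L_def using that \<alpha> by (intro mult_left_mono) auto
    thus "\<alpha> * ln x + \<phi> \<le> pi" by (simp add: \<phi>_def)
  qed

  \<comment> \<open>The absolute value and the lower limit \<open>-1\<close> extend the integrand beyond \<open>{0..pi}\<close>, so that \<open>S\<close> is
    differentiable at both end points.\<close>
  define S where "S t = integral {-1..t} (\<lambda>t. \<bar>sin t\<bar> powr p)" for t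
  have dS: "(S has_real_derivative sin t powr p) (at t)" if "0 \<le> t" "t \<le> pi" for t
  proof -
    have t: "t \<in> {-1<..<4}" using that pi_less_4 by auto
    have "continuous_on {-1..4} (\<lambda>t::real. \<bar>sin t\<bar> powr p)"
      using p by (intro continuous_on_powr' continuous_intros) auto
    hence "(S has_real_derivative \<bar>sin t\<bar> powr p) (at t within {-1..4})"
      unfolding S_def using t by (intro integral_has_real_derivative) auto
    hence "(S has_real_derivative \<bar>sin t\<bar> powr p) (at t)"
      using t at_within_interior[of t "{-1..4}"] by (simp add: interior_atLeastAtMost_real)
    thus ?thesis using sin_ge_zero[OF that] by simp
  qed
  have S_sym: "S pi - S \<phi> = S (pi - \<phi>) - S 0"
  proof -
    have d: "((\<lambda>t. - S (pi - t)) has_real_derivative sin t powr p) (at t)" if "\<phi> \<le> t" "t \<le> pi" for t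
    proof -
      have "(S has_real_derivative sin t powr p) (at (pi - t))"
        using dS[of "pi - t"] that \<phi> by simp
      hence "((\<lambda>t. S (pi - t)) has_real_derivative sin t powr p * (-1)) (at t)"
        by (rule DERIV_chain2) (auto intro!: derivative_eq_intros)
      from DERIV_minus[OF this] show ?thesis by simp
    qed
    have "S pi - S \<phi> \<le> - S (pi - pi) - - S (pi - \<phi>)"
      by (rule increment_mono[OF _ dS d]) (use \<phi> in auto)
    moreover have "- S (pi - pi) - - S (pi - \<phi>) \<le> S pi - S \<phi>"
      by (rule increment_mono[OF _ d dS]) (use \<phi> in auto)
    ultimately show ?thesis by simp
  qed

  define F where "F x = q * x powr (1 - 1 / p) * sin (\<alpha> * ln x)" for x
  have fstar_eq: "fstar p \<alpha> x = x powr (- 1 / p) * (sin (\<alpha> * ln x + \<phi>) / cos \<phi>)" for x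
  proof -
    have "sin (\<alpha> * ln x + \<phi>) / cos \<phi> = b * cos (\<alpha> * ln x) + sin (\<alpha> * ln x)"
      using cos_\<phi> unfolding tan_\<phi>[symmetric] tan_def sin_add by (simp add: field_simps)
    thus ?thesis by (simp add: fstar_def b_def powr_minus_divide)
  qed
  have fstar_nonneg: "0 \<le> fstar p \<alpha> x" if "1 \<le> x" "x \<le> real n + 1" for x
    unfolding fstar_eq using angle[OF that] \<phi> cos_\<phi>
    by (intro mult_nonneg_nonneg divide_nonneg_pos sin_ge_zero) auto
  have dF: "(F has_real_derivative fstar p \<alpha> x) (at x)" if x: "1 \<le> x" for x
  proof -
    have "(F has_real_derivative q * ((1 - 1 / p) * x powr (1 - 1 / p - 1)) * sin (\<alpha> * ln x)
        + q * x powr (1 - 1 / p) * (cos (\<alpha> * ln x) * (\<alpha> / x))) (at x)"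
      unfolding F_def using x by (auto intro!: derivative_eq_intros simp: field_simps)
    also have "q * ((1 - 1 / p) * x powr (1 - 1 / p - 1)) * sin (\<alpha> * ln x)
        + q * x powr (1 - 1 / p) * (cos (\<alpha> * ln x) * (\<alpha> / x)) = fstar p \<alpha> x"
    proof -
      have "q * (1 - 1 / p) = 1" using p by (simp add: q_def field_simps)
      moreover have "x powr (1 - 1 / p) = x * x powr (- (1 / p))"
        using x powr_mult_base[of x "- (1 / p)"] by simp
      ultimately show ?thesis using x
        by (simp add: fstar_def q_def powr_minus_divide algebra_simps)
    qed
    finally show ?thesis .
  qed
  have F_mono: "F x \<le> F y" if "1 \<le> x" "x \<le> y" "y \<le> real n + 1" for x y
  proof -
    have "(\<lambda>_. 0) y - (\<lambda>_. 0) x \<le> F y - F x"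
      by (rule increment_mono[where g' = "\<lambda>_. 0" and h' = "fstar p \<alpha>"])
        (use that in \<open>auto intro!: dF fstar_nonneg\<close>)
    thus ?thesis by simp
  qed
  have F1: "F 1 = 0" by (simp add: F_def)
  have astar: "astar p \<alpha> k = F (real k + 1) - F (real k)" if "1 \<le> k" for k
  proof -
    have "(fstar p \<alpha> has_integral F (real k + 1) - F (real k)) {real k..real k + 1}"
      using that by (intro fundamental_theorem_of_calculus)
        (auto simp: has_real_derivative_iff_has_vector_derivative[symmetric]
          intro!: has_field_derivative_at_within dF)
    thus ?thesis unfolding astar_def by (rule integral_unique)
  qed
  have sum_astar: "(\<Sum>j=1..k. astar p \<alpha> j) = F (real k + 1)" for k
    by (induction k) (simp_all add: F1 astar add.commute)
  show nonneg: "\<forall>k\<in>{1..n}. 0 \<le> astar p \<alpha> k"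
    using F_mono by (auto simp: astar)
  have "\<alpha> * ln 2 < pi" using angle(2)[of 2] \<phi> n by simp
  hence "0 < F 2" unfolding F_def using q \<alpha> by (intro mult_pos_pos sin_gt_zero) auto
  hence "0 < astar p \<alpha> 1 powr p" using astar[of 1] F1 by simp
  also have "\<dots> \<le> (\<Sum>k=1..n. astar p \<alpha> k powr p)" using n by (intro member_le_sum) auto
  finally show "0 < (\<Sum>k=1..n. astar p \<alpha> k powr p)" .

  have powr_root: "(x powr (- 1 / p)) powr p = 1 / x" if "1 \<le> x" for x
  proof -
    have "- 1 / p * p = - 1" using p by simp
    thus ?thesis using that by (simp only: powr_powr) (simp add: powr_minus_divide)
  qed
  define R where "R x = q powr p / \<alpha> * S (\<alpha> * ln x)" for x
  define T where "T x = (1 / cos \<phi>) powr p / \<alpha> * S (\<alpha> * ln x + \<phi>)" for x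
  have dR: "(R has_real_derivative (F x / x) powr p) (at x)" if x: "1 \<le> x" "x \<le> real n + 1" for x
  proof -
    have "((\<lambda>x. S (\<alpha> * ln x)) has_real_derivative sin (\<alpha> * ln x) powr p * (\<alpha> / x)) (at x)"
      using angle[OF x] \<phi> x
      by (intro DERIV_chain2[OF dS]) (auto intro!: derivative_eq_intros)
    from DERIV_cmult[OF this, of "q powr p / \<alpha>"]
    have "(R has_real_derivative q powr p / \<alpha> * (sin (\<alpha> * ln x) powr p * (\<alpha> / x))) (at x)"
      by (simp only: R_def[abs_def])
    moreover have "(F x / x) powr p = q powr p / \<alpha> * (sin (\<alpha> * ln x) powr p * (\<alpha> / x))"
    proof -
      have "F x / x = q * x powr (- 1 / p) * sin (\<alpha> * ln x)"
      proof -
        have "x powr (1 - 1 / p) = x * x powr (- 1 / p)"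
          using x powr_mult_base[of x "- 1 / p"] by simp
        thus ?thesis using x by (simp add: F_def)
      qed
      moreover note powr_root[OF x(1)]
      moreover have "0 \<le> sin (\<alpha> * ln x)" using angle[OF x] \<phi> by (intro sin_ge_zero) auto
      ultimately show ?thesis using q \<alpha> x by (simp add: powr_mult del: minus_divide_left)
    qed
    ultimately show ?thesis by simp
  qed
  have dT: "(T has_real_derivative fstar p \<alpha> x powr p) (at x)" if x: "1 \<le> x" "x \<le> real n + 1" for x
  proof -
    have "((\<lambda>x. S (\<alpha> * ln x + \<phi>)) has_real_derivative sin (\<alpha> * ln x + \<phi>) powr p * (\<alpha> / x)) (at x)"
      using angle[OF x] \<phi> x
      by (intro DERIV_chain2[OF dS]) (auto intro!: derivative_eq_intros)
    from DERIV_cmult[OF this, of "(1 / cos \<phi>) powr p / \<alpha>"]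
    have "(T has_real_derivative (1 / cos \<phi>) powr p / \<alpha> * (sin (\<alpha> * ln x + \<phi>) powr p * (\<alpha> / x))) (at x)"
      by (simp only: T_def[abs_def])
    moreover have "fstar p \<alpha> x powr p = (1 / cos \<phi>) powr p / \<alpha> * (sin (\<alpha> * ln x + \<phi>) powr p * (\<alpha> / x))"
    proof -
      note powr_root[OF x(1)]
      moreover have "0 \<le> sin (\<alpha> * ln x + \<phi>)" using angle[OF x] \<phi> by (intro sin_ge_zero) auto
      ultimately show ?thesis using \<alpha> x cos_\<phi> by (simp add: fstar_eq powr_mult powr_divide)
    qed
    ultimately show ?thesis by simp
  qed

  have "(\<Sum>k=1..n. astar p \<alpha> k powr p) \<le> (\<Sum>k=1..n. T (real k + 1) - T (real k))"
  proof (rule sum_mono)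
    fix k assume k: "k \<in> {1..n}"
    have "(F (real k + 1) - F (real k)) powr p \<le> T (real k + 1) - T (real k)"
      by (rule powr_unit_increment_le[where f = "fstar p \<alpha>"])
        (use k p in \<open>auto intro!: dF dT fstar_nonneg\<close>)
    thus "astar p \<alpha> k powr p \<le> T (real k + 1) - T (real k)" using astar k by simp
  qed
  also have "\<dots> = T (real n + 1) - T 1"
    using sum_Suc_diff[of 1 n "\<lambda>k. T (real k)"] n by (simp add: add.commute)
  also have "\<dots> = (1 / cos \<phi>) powr p / \<alpha> * (S pi - S \<phi>)"
  proof -
    have "\<alpha> * ln (real n + 1) + \<phi> = pi" by (simp add: \<phi>_def L_def)
    thus ?thesis by (simp add: T_def right_diff_distrib)
  qed
  finally have upper: "(\<Sum>k=1..n. astar p \<alpha> k powr p) \<le> (1 / cos \<phi>) powr p / \<alpha> * (S pi - S \<phi>)" .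

  have "q powr p / \<alpha> * (S pi - S \<phi>) = R (real n + 1) - R 1"
    unfolding S_sym by (simp add: R_def \<phi>_def L_def algebra_simps)
  also have "\<dots> = (\<Sum>k=1..n. R (real k + 1) - R (real k))"
    using sum_Suc_diff[of 1 n "\<lambda>k. R (real k)"] n by (simp add: add.commute)
  also have "\<dots> \<le> (\<Sum>k=1..n. ((1 / real k) * (\<Sum>j=1..k. astar p \<alpha> j)) powr p)"
  proof (rule sum_mono)
    fix k assume k: "k \<in> {1..n}"
    let ?c = "(F (real k + 1) / real k) powr p"
    have "R (real k + 1) - R (real k) \<le> ?c * (real k + 1) - ?c * real k"
    proof (rule increment_mono[where h = "\<lambda>x. ?c * x"])
      fix x assume x: "real k \<le> x" "x \<le> real k + 1"
      show "(R has_real_derivative (F x / x) powr p) (at x)" using k x by (intro dR) auto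
      show "((\<lambda>x. ?c * x) has_real_derivative ?c) (at x)" by (auto intro!: derivative_eq_intros)
      have "0 \<le> F x" using F_mono[of 1 x] F1 k x by simp
      moreover have "F x \<le> F (real k + 1)" using k x by (intro F_mono) auto
      ultimately show "(F x / x) powr p \<le> ?c"
        using k x p by (intro powr_mono2 frac_le divide_nonneg_pos) auto
    qed simp
    thus "R (real k + 1) - R (real k) \<le> ((1 / real k) * (\<Sum>j=1..k. astar p \<alpha> j)) powr p"
      unfolding sum_astar by (simp add: algebra_simps)
  qed
  finally have lower: "q powr p / \<alpha> * (S pi - S \<phi>)
      \<le> (\<Sum>k=1..n. ((1 / real k) * (\<Sum>j=1..k. astar p \<alpha> j)) powr p)" .

  have cos_powr: "(1 + b\<^sup>2) powr (- (p / 2)) = cos \<phi> powr p"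
  proof -
    have "1 + b\<^sup>2 = (1 / cos \<phi>)\<^sup>2"
      using tan_sec[of \<phi>] cos_\<phi> by (simp add: tan_\<phi> inverse_eq_divide)
    also have "\<dots> = cos \<phi> powr (- 2)"
      using cos_\<phi> by (simp add: powr_minus_divide power_one_over)
    finally show ?thesis by (simp add: powr_powr)
  qed
  have "q powr p * (1 + b\<^sup>2) powr (- (p / 2)) * (\<Sum>k=1..n. astar p \<alpha> k powr p)
      \<le> q powr p * cos \<phi> powr p * ((1 / cos \<phi>) powr p / \<alpha> * (S pi - S \<phi>))"
    unfolding cos_powr by (intro mult_left_mono upper) auto
  also have "\<dots> = q powr p / \<alpha> * (S pi - S \<phi>)"
    using cos_\<phi> by (simp add: powr_divide)
  also note lower
  finally show "(p / (p - 1)) powr p * (1 + b\<^sup>2) powr (- (p / 2)) * (\<Sum>k=1..n. astar p \<alpha> k powr p)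
      \<le> (\<Sum>k=1..n. ((1 / real k) * (\<Sum>j=1..k. astar p \<alpha> j)) powr p)" by (simp add: q_def)
qed

text \<open>Here \<open>p \<ge> 2\<close> enters through \<open>q = p / (p - 1) \<le> 2\<close>: the argument yields the constant
  \<open>q powr (p + 2) * p * pi\<^sup>2 / 2\<close>, which is \<open>q / 2\<close> times the asserted one; the two agree for
  \<open>p = 2\<close>.\<close>

lemma astar_almost_extremal:
  fixes p \<alpha> :: real
  assumes p: "2 \<le> p" and n: "2 \<le> n" and alpha: "alpha_eq p n \<alpha>"
  shows "((p / (p - 1)) powr p - (p / (p - 1)) powr (p + 1) * p * pi\<^sup>2 / (ln (real n))\<^sup>2)
        * (\<Sum>k=1..n. astar p \<alpha> k powr p)
      \<le> (\<Sum>k=1..n. ((1 / real k) * (\<Sum>j=1..k. astar p \<alpha> j)) powr p)"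
proof -
  define q where "q = p / (p - 1)"
  define b where "b = \<alpha> * q"
  have q: "0 < q" "q \<le> 2" using p by (auto simp: q_def field_simps)
  have ln: "0 < ln (real n)" using n by simp
  have "0 < pi / (2 * ln (real n + 1))" using n by simp
  hence \<alpha>: "0 < \<alpha>" using alpha by (auto simp: alpha_eq_def)
  have "\<alpha> < pi / ln (real n + 1)" using alpha by (simp add: alpha_eq_def)
  also have "\<dots> \<le> pi / ln (real n)" using n by (intro divide_left_mono) auto
  finally have "\<alpha>\<^sup>2 \<le> (pi / ln (real n))\<^sup>2" using \<alpha> by (intro power_mono) auto
  hence \<alpha>2: "\<alpha>\<^sup>2 \<le> pi\<^sup>2 / (ln (real n))\<^sup>2" by (simp add: power_divide)
  \<comment> \<open>Bernoulli's inequality for a negative exponent, through \<open>1 + x \<le> exp x\<close> and \<open>ln (1 + x) \<le> x\<close>.\<close>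
  have "1 - p / 2 * b\<^sup>2 \<le> 1 + - (p / 2) * ln (1 + b\<^sup>2)"
    using p ln_add_one_self_le_self[of "b\<^sup>2"] by simp
  also have "\<dots> \<le> exp (- (p / 2) * ln (1 + b\<^sup>2))" by (rule exp_ge_add_one_self)
  also have "\<dots> = (1 + b\<^sup>2) powr (- (p / 2))"
    using sum_power2_gt_zero_iff[of 1 b] by (simp add: powr_def)
  finally have bern: "1 - p / 2 * b\<^sup>2 \<le> (1 + b\<^sup>2) powr (- (p / 2))" .
  have "q powr (p + 1) = q powr p * q" using q by (simp add: powr_add)
  moreover have "p / 2 * b\<^sup>2 \<le> q * p * pi\<^sup>2 / (ln (real n))\<^sup>2"
  proof -
    have "p / 2 * b\<^sup>2 = (q * p) * (q / 2) * \<alpha>\<^sup>2" by (simp add: b_def power2_eq_square)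
    also have "\<dots> \<le> (q * p) * 1 * (pi\<^sup>2 / (ln (real n))\<^sup>2)"
      using q p \<alpha>2 by (intro mult_mono) auto
    finally show ?thesis by simp
  qed
  ultimately have "q powr p - q powr (p + 1) * p * pi\<^sup>2 / (ln (real n))\<^sup>2
      \<le> q powr p * (1 - p / 2 * b\<^sup>2)"
    using mult_left_mono[of "p / 2 * b\<^sup>2" "q * p * pi\<^sup>2 / (ln (real n))\<^sup>2" "q powr p"]
    by (simp add: algebra_simps)
  also have "\<dots> \<le> q powr p * (1 + b\<^sup>2) powr (- (p / 2))" by (intro mult_left_mono bern) simp
  finally have "(q powr p - q powr (p + 1) * p * pi\<^sup>2 / (ln (real n))\<^sup>2) * (\<Sum>k=1..n. astar p \<alpha> k powr p)
      \<le> q powr p * (1 + b\<^sup>2) powr (- (p / 2)) * (\<Sum>k=1..n. astar p \<alpha> k powr p)"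
    by (intro mult_right_mono sum_nonneg) auto
  also have "\<dots> \<le> (\<Sum>k=1..n. ((1 / real k) * (\<Sum>j=1..k. astar p \<alpha> j)) powr p)"
    using astar_hardy_ratio(3)[of p n \<alpha>] p n alpha by (simp add: q_def b_def)
  finally show ?thesis by (simp add: q_def)
qed

section \<open>A Schur test for the Hardy constant\<close>

text \<open>A Schur test. The hypothesis says that \<open>v\<close> is a positive supersolution of the Euler--Lagrange
  equation of the Hardy quotient, in differenced form. Summing it over \<open>j, \<dots>, n\<close>
  bounds the column sums of the kernel that arises when the \<open>k\<close>-th partial sum of \<open>a\<close> is
  estimated by Hoelder's inequality with weights \<open>v\<close>. The value \<open>v (Suc n)\<close> is a boundary term
  of favourable sign.\<close>

lemma hardy_const_le_of_supersolution:
  fixes v :: "nat \<Rightarrow> real"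
  assumes p: "1 < p" and n: "1 \<le> n" and lam: "0 < lam"
    and v: "\<And>j. j \<in> {1..n} \<Longrightarrow> 0 < v j"
    and super: "\<And>j. j \<in> {1..n} \<Longrightarrow>
        lam * (real j powr (- p) * (\<Sum>i=1..j. v i) powr (p - 1)) \<le> v j powr (p - 1) - v (Suc j) powr (p - 1)"
  shows "hardy_const p n \<le> 1 / lam"
proof (rule hardy_const_least(2))
  define w where "w k = real k powr (- p) * (\<Sum>i=1..k. v i) powr (p - 1)" for k
  have tail: "lam * (\<Sum>k=j..n. w k) \<le> v j powr (p - 1)" if j: "j \<in> {1..n}" for j
  proof -
    have "lam * (\<Sum>k=j..n. w k) \<le> (\<Sum>k=j..n. v k powr (p - 1) - v (Suc k) powr (p - 1))"
      unfolding sum_distrib_left w_def using super j by (intro sum_mono) auto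
    also have "\<dots> = v j powr (p - 1) - v (Suc n) powr (p - 1)"
      using sum_Suc_diff[of j n "\<lambda>k. - (v k powr (p - 1))"] j by simp
    also have "\<dots> \<le> v j powr (p - 1)" by simp
    finally show ?thesis .
  qed
  show "\<forall>a. (\<forall>k\<in>{1..n}. 0 \<le> a k) \<longrightarrow> finite_hardy p n a (1 / lam)"
    unfolding finite_hardy_def
  proof (intro allI impI)
    fix a :: "nat \<Rightarrow> real" assume a: "\<forall>k\<in>{1..n}. 0 \<le> a k"
    define b where "b j = a j powr p * v j powr (1 - p)" for j
    have "(\<Sum>k=1..n. ((1 / real k) * (\<Sum>j=1..k. a j)) powr p) \<le> (\<Sum>k=1..n. \<Sum>j=1..k. w k * b j)"
    proof (rule sum_mono)
      fix k assume k: "k \<in> {1..n}"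
      have "((1 / real k) * (\<Sum>j=1..k. a j)) powr p = real k powr (- p) * (\<Sum>j=1..k. a j) powr p"
        using k a by (simp add: powr_mult powr_divide powr_minus_divide sum_nonneg)
      also have "\<dots> \<le> real k powr (- p) * ((\<Sum>i=1..k. v i) powr (p - 1) * (\<Sum>j=1..k. b j))"
        unfolding b_def using k a v p by (intro mult_left_mono powr_sum_le_weighted) auto
      finally show "((1 / real k) * (\<Sum>j=1..k. a j)) powr p \<le> (\<Sum>j=1..k. w k * b j)"
        by (simp add: w_def sum_distrib_left mult.assoc)
    qed
    also have "\<dots> = (\<Sum>j=1..n. \<Sum>k=j..n. w k * b j)"
    proof -
      have "(\<Sum>k=1..n. \<Sum>j | j \<in> {1..n} \<and> j \<le> k. w k * b j) = (\<Sum>j=1..n. \<Sum>k | k \<in> {1..n} \<and> j \<le> k. w k * b j)"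
        by (rule sum.swap_restrict) auto
      moreover have "{j. j \<in> {1..n} \<and> j \<le> k} = {1..k}" if "k \<in> {1..n}" for k
        using that by auto
      moreover have "{k. k \<in> {1..n} \<and> j \<le> k} = {j..n}" if "j \<in> {1..n}" for j
        using that by auto
      ultimately show ?thesis by simp
    qed
    also have "\<dots> \<le> (\<Sum>j=1..n. (1 / lam) * a j powr p)"
    proof (rule sum_mono)
      fix j assume j: "j \<in> {1..n}"
      have "(\<Sum>k=j..n. w k * b j) = (\<Sum>k=j..n. w k) * b j" by (simp add: sum_distrib_right)
      also have "\<dots> \<le> (v j powr (p - 1) / lam) * b j"
        using tail[OF j] lam by (intro mult_right_mono) (auto simp: b_def field_simps)
      also have "\<dots> = (1 / lam) * a j powr p"
        using v[OF j] by (simp add: b_def powr_diff field_simps)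
      finally show "(\<Sum>k=j..n. w k * b j) \<le> (1 / lam) * a j powr p" .
    qed
    finally show "(\<Sum>k=1..n. ((1 / real k) * (\<Sum>j=1..k. a j)) powr p) \<le> 1 / lam * (\<Sum>k=1..n. a k powr p)"
      by (simp add: sum_distrib_left)
  qed
qed (use p n in auto)

text \<open>A sequence of length \<open>m\<close> is prolonged by zeros. The theorem uses this to pass from all large
  \<open>n\<close> to all \<open>n \<ge> 2\<close>.\<close>

lemma hardy_const_mono:
  assumes "0 < p" "1 \<le> m" "m \<le> n"
  shows "hardy_const p m \<le> hardy_const p n"
proof (rule hardy_const_least(2)[OF assms(1,2)], intro allI impI)
  fix a :: "nat \<Rightarrow> real" assume a: "\<forall>k\<in>{1..m}. 0 \<le> a k"
  define b where "b k = (if k \<le> m then a k else 0)" for k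
  have "finite_hardy p n b (hardy_const p n)"
    using hardy_const_least(1)[of p n] assms a by (auto simp: b_def)
  hence b: "(\<Sum>k=1..n. ((1 / real k) * (\<Sum>j=1..k. b j)) powr p) \<le> hardy_const p n * (\<Sum>k=1..n. b k powr p)"
    by (simp add: finite_hardy_def)
  have "(\<Sum>k=1..m. ((1 / real k) * (\<Sum>j=1..k. a j)) powr p)
      = (\<Sum>k=1..m. ((1 / real k) * (\<Sum>j=1..k. b j)) powr p)"
    by (intro sum.cong refl arg_cong2[where f = "(powr)"] arg_cong2[where f = "(*)"]) (auto simp: b_def)
  also have "\<dots> \<le> (\<Sum>k=1..n. ((1 / real k) * (\<Sum>j=1..k. b j)) powr p)"
    using assms by (intro sum_mono2) auto
  also note b
  also have "(\<Sum>k=1..n. b k powr p) = (\<Sum>k=1..m. a k powr p)"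
    using assms by (intro sum.mono_neutral_cong_right) (auto simp: b_def)
  finally show "finite_hardy p m a (hardy_const p n)" by (simp add: finite_hardy_def)
qed

text \<open>The step from the continuous to the discrete problem, taken without loss in the constant. The
  weights are the values \<open>v j = f (j - 1/2)\<close> at midpoints. Convexity of \<open>f\<close> gives
  \<open>v j \<le> F j - F (j - 1)\<close>, so the partial sums of \<open>v\<close> are at most \<open>F\<close>. Convexity of \<open>w\<close>
  gives that \<open>w j\<close> is at most the integral of \<open>w\<close> over \<open>{j - 1/2..j + 1/2}\<close>, so the
  differential inequality for \<open>f powr (p - 1)\<close> integrates to the hypothesis of the Schur test.
  The condition on \<open>f (1/2)\<close> replaces the step \<open>j = 1\<close>, which would involve \<open>F 0\<close>.\<close>

lemma hardy_const_le_of_convex_profile: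
  fixes F f w :: "real \<Rightarrow> real" and n :: nat
  defines "I \<equiv> {1/2..real n + 1/2}"
  assumes p: "1 < p" and n: "1 \<le> n" and lam: "0 < lam"
    and dF: "\<And>x. x \<in> I \<Longrightarrow> (F has_real_derivative f x) (at x)"
    and df: "\<And>x. x \<in> I \<Longrightarrow> (f has_real_derivative f' x) (at x)"
    and dw: "\<And>x. x \<in> I \<Longrightarrow> (w has_real_derivative w' x) (at x)"
    and cf: "convex_on I f" and cw: "convex_on I w"
    and f: "\<And>x. x \<in> I \<Longrightarrow> 0 < f x" and first: "f (1/2) \<le> F 1"
    and w: "\<And>x. x \<in> I \<Longrightarrow> w x = x powr (- p) * F x powr (p - 1)"
    and super: "\<And>x. x \<in> I \<Longrightarrow> lam * w x \<le> - ((p - 1) * f x powr (p - 2) * f' x)"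
  shows "hardy_const p n \<le> 1 / lam"
proof -
  define v where "v j = f (real j - 1/2)" for j
  have v: "0 < v j" if "j \<in> {1..Suc n}" for j
    unfolding v_def using that by (intro f) (auto simp: I_def)
  have V_le: "(\<Sum>i=1..k. v i) \<le> F (real k)" if "1 \<le> k" "k \<le> n" for k
    using that
  proof (induction k rule: nat_induct_at_least)
    case base
    show ?case using first by (simp add: v_def)
  next
    case (Suc k)
    have sub: "{real k + 1/2 - 1/2..real k + 1/2 + 1/2} \<subseteq> I"
      using Suc by (auto simp: I_def)
    have "2 * (1/2) * f (real k + 1/2) \<le> F (real k + 1/2 + 1/2) - F (real k + 1/2 - 1/2)"
    proof (rule midpoint_increment)
      show "convex_on {real k + 1/2 - 1/2..real k + 1/2 + 1/2} f"
        by (rule convex_on_subset[OF cf sub]) simp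
      show "(f has_real_derivative f' (real k + 1/2)) (at (real k + 1/2))"
        using sub by (intro df) auto
    qed (use sub dF in auto)
    thus ?case using Suc by (simp add: v_def algebra_simps)
  qed
  show ?thesis
  proof (rule hardy_const_le_of_supersolution[OF p n lam])
    show "0 < v j" if "j \<in> {1..n}" for j using v that by simp
    fix j assume j: "j \<in> {1..n}"
    have sub: "{real j - 1/2..real j + 1/2} \<subseteq> I" using j by (auto simp: I_def)
    have dfp: "((\<lambda>x. - (f x powr (p - 1))) has_real_derivative - ((p - 1) * f x powr (p - 2) * f' x)) (at x)"
      if "x \<in> I" for x
      using DERIV_minus[OF DERIV_fun_powr[OF df[OF that] f[OF that], of "p - 1"]] by simp
    have "2 * (1/2) * (lam * w (real j)) \<le> - (f (real j + 1/2) powr (p - 1)) - - (f (real j - 1/2) powr (p - 1))"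
    proof (rule midpoint_increment[where w = "\<lambda>x. lam * w x"
          and g' = "\<lambda>x. - ((p - 1) * f x powr (p - 2) * f' x)"])
      show "convex_on {real j - 1/2..real j + 1/2} (\<lambda>x. lam * w x)"
        using lam sub by (intro convex_on_cmul convex_on_subset[OF cw]) auto
      show "((\<lambda>x. lam * w x) has_real_derivative lam * w' (real j)) (at (real j))"
        using sub by (intro DERIV_cmult dw) auto
    qed (use sub dfp super in auto)
    hence "lam * w (real j) \<le> v j powr (p - 1) - v (Suc j) powr (p - 1)"
      by (simp add: v_def algebra_simps)
    moreover have "lam * (real j powr (- p) * (\<Sum>i=1..j. v i) powr (p - 1)) \<le> lam * w (real j)"
    proof -
      have "(\<Sum>i=1..j. v i) powr (p - 1) \<le> F (real j) powr (p - 1)"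
        using V_le[of j] v j p by (intro powr_mono2 sum_nonneg) (auto intro: less_imp_le)
      moreover have "w (real j) = real j powr (- p) * F (real j) powr (p - 1)"
        using sub by (intro w) auto
      ultimately show ?thesis using lam by (simp add: mult_left_mono)
    qed
    ultimately show "lam * (real j powr (- p) * (\<Sum>i=1..j. v i) powr (p - 1))
        \<le> v j powr (p - 1) - v (Suc j) powr (p - 1)" by linarith
  qed
qed

section \<open>Logarithmic trigonometric profiles\<close>

text \<open>The logarithmic derivative of \<open>sin (\<alpha> * t + \<phi>) powr m\<close> with respect to \<open>t = ln x\<close>. As a
  function of \<open>t\<close> it solves the Riccati equation \<open>r' = - (m * \<alpha>\<^sup>2 + r\<^sup>2 / m)\<close>.\<close>

definition log_cot :: "real \<Rightarrow> real \<Rightarrow> real \<Rightarrow> real \<Rightarrow> real" where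
  "log_cot m \<alpha> \<phi> x = m * \<alpha> * cot (\<alpha> * ln x + \<phi>)"

text \<open>A family of functions that contains the profile \<open>F\<close>, its derivative \<open>f\<close> and the weight \<open>w\<close>,
  and is closed under differentiation: by the Riccati equation only the exponent of \<open>x\<close> and
  the polynomial \<open>P\<close> change.\<close>

definition log_trig ::
  "real \<Rightarrow> real \<Rightarrow> real \<Rightarrow> real \<Rightarrow> real \<Rightarrow> (real \<Rightarrow> real) \<Rightarrow> real \<Rightarrow> real" where
  "log_trig m \<alpha> \<phi> k e P x =
     x powr k * sin (\<alpha> * ln x + \<phi>) powr (m * e) * P (log_cot m \<alpha> \<phi> x)"

lemma has_real_derivative_log_trig:
  assumes m: "0 < m" and x: "0 < x" and s: "0 < sin (\<alpha> * ln x + \<phi>)"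
    and P: "(P has_real_derivative P') (at (log_cot m \<alpha> \<phi> x))"
    and k': "k' = k - 1"
    and Q: "Q (log_cot m \<alpha> \<phi> x) = (k + e * log_cot m \<alpha> \<phi> x) * P (log_cot m \<alpha> \<phi> x)
              - (m * \<alpha>\<^sup>2 + (log_cot m \<alpha> \<phi> x)\<^sup>2 / m) * P'"
  shows "(log_trig m \<alpha> \<phi> k e P has_real_derivative log_trig m \<alpha> \<phi> k' e Q x) (at x)"
proof -
  define r where "r = log_cot m \<alpha> \<phi> x"
  define S C where "S = sin (\<alpha> * ln x + \<phi>)" and "C = cos (\<alpha> * ln x + \<phi>)"
  have S: "0 < S" using s by (simp add: S_def)
  have r: "r = m * \<alpha> * C / S" by (simp add: r_def log_cot_def cot_def S_def C_def)
  have "S\<^sup>2 + C\<^sup>2 = 1" by (simp add: S_def C_def)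
  have dr: "(log_cot m \<alpha> \<phi> has_real_derivative - (m * \<alpha>\<^sup>2 + r\<^sup>2 / m) / x) (at x)"
  proof -
    have "((\<lambda>y. m * \<alpha> * (cos (\<alpha> * ln y + \<phi>) / sin (\<alpha> * ln y + \<phi>))) has_real_derivative
        m * \<alpha> * (((- S * (\<alpha> / x)) * S - C * (C * (\<alpha> / x))) / (S * S))) (at x)"
      using x S by (auto intro!: derivative_eq_intros simp: S_def C_def field_simps)
    moreover have "(\<lambda>y. m * \<alpha> * (cos (\<alpha> * ln y + \<phi>) / sin (\<alpha> * ln y + \<phi>))) = log_cot m \<alpha> \<phi>"
      by (simp add: log_cot_def cot_def fun_eq_iff)
    moreover have "m * \<alpha> * (((- S * (\<alpha> / x)) * S - C * (C * (\<alpha> / x))) / (S * S))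
        = - (m * \<alpha>\<^sup>2 + r\<^sup>2 / m) / x"
      using x S m by (simp add: r field_simps power2_eq_square)
    ultimately show ?thesis by simp
  qed
  have dP: "((\<lambda>y. P (log_cot m \<alpha> \<phi> y)) has_real_derivative P' * (- (m * \<alpha>\<^sup>2 + r\<^sup>2 / m) / x)) (at x)"
    by (rule DERIV_chain2[OF P dr])
  have dS: "((\<lambda>y. sin (\<alpha> * ln y + \<phi>) powr (m * e)) has_real_derivative
      m * e * S powr (m * e - 1) * (C * (\<alpha> / x))) (at x)"
    using x S by (auto intro!: derivative_eq_intros simp: S_def C_def)
  have dx: "((\<lambda>y. y powr k) has_real_derivative k * x powr (k - 1)) (at x)"
    using x by (auto intro!: derivative_eq_intros)
  have "(log_trig m \<alpha> \<phi> k e P has_real_derivative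
      ((k * x powr (k - 1)) * S powr (m * e) + (m * e * S powr (m * e - 1) * (C * (\<alpha> / x))) * x powr k) * P r
      + P' * (- (m * \<alpha>\<^sup>2 + r\<^sup>2 / m) / x) * (x powr k * S powr (m * e))) (at x)"
    using DERIV_mult[OF DERIV_mult[OF dx dS] dP] by (simp add: log_trig_def[abs_def] r_def S_def)
  also have "((k * x powr (k - 1)) * S powr (m * e) + (m * e * S powr (m * e - 1) * (C * (\<alpha> / x))) * x powr k) * P r
      + P' * (- (m * \<alpha>\<^sup>2 + r\<^sup>2 / m) / x) * (x powr k * S powr (m * e))
      = log_trig m \<alpha> \<phi> k' e Q x"
  proof -
    define X Z \<rho> where "X = x powr (k - 1)" and "Z = S powr (m * e)" and "\<rho> = m * \<alpha>\<^sup>2 + r\<^sup>2 / m"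
    have Z: "S powr (m * e - 1) = Z / S" using S by (simp add: powr_diff Z_def)
    have X: "x powr k = x * X" using powr_mult_base[of x "k - 1"] x by (simp add: X_def)
    have "m * e * (Z / S) * (C * (\<alpha> / x)) * (x * X) = e * r * (Z * X)"
      using x S by (simp add: r)
    moreover have "P' * (- \<rho> / x) * (x * X * Z) = - \<rho> * P' * (X * Z)"
      using x by simp
    moreover have "Q r = (k + e * r) * P r - \<rho> * P'"
      using Q by (simp add: r_def \<rho>_def)
    hence "log_trig m \<alpha> \<phi> k' e Q x = X * Z * ((k + e * r) * P r - \<rho> * P')"
      unfolding log_trig_def k' r_def[symmetric] S_def[symmetric] X_def Z_def by simp
    ultimately show ?thesis
      unfolding X Z X_def[symmetric] Z_def[symmetric] \<rho>_def[symmetric]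
      by (simp add: algebra_simps)
  qed
  finally show ?thesis .
qed

text \<open>The profile is \<open>F x = x powr (1 - 1 / p) * sin (\<alpha> * ln x + \<phi>) powr m\<close>. All conditions on it become
  conditions on the number \<open>r\<close>, the value of the slowly varying function \<^const>\<open>log_cot\<close>:
  \<open>c1\<close> says that \<open>f\<close> is positive, \<open>c2\<close> and \<open>c3\<close> that the second derivatives of \<open>f\<close> and
  \<open>w\<close> are nonnegative, \<open>c4\<close> implies \<open>f (1/2) \<le> F 1\<close>, and \<open>c5\<close> is the differential inequality.\<close>

lemma hardy_const_le_of_log_trig:
  fixes p m \<alpha> \<phi> lam :: real and n :: nat
  defines "I \<equiv> {1/2..real n + 1/2}" and "u \<equiv> 1 / p"
  defines "\<rho> \<equiv> \<lambda>r. m * \<alpha>\<^sup>2 + r\<^sup>2 / m"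
  assumes p: "2 \<le> p" and m: "0 < m" and n: "1 \<le> n" and lam: "0 < lam" and \<alpha>: "0 < \<alpha>"
    and left: "0 < \<alpha> * ln (1/2) + \<phi>" and right: "\<alpha> * ln (real n + 1/2) + \<phi> < pi" and \<phi>: "\<phi> \<le> pi / 2"
    and r: "\<And>x. x \<in> I \<Longrightarrow> \<bar>log_cot m \<alpha> \<phi> x\<bar> \<le> \<eta>"
    and c1: "\<And>r. \<bar>r\<bar> \<le> \<eta> \<Longrightarrow> 0 < 1 - u + r"
    and c2: "\<And>r. \<bar>r\<bar> \<le> \<eta> \<Longrightarrow>
        0 \<le> (- u - 1 + r) * ((- u + r) * (1 - u + r) - \<rho> r) - \<rho> r * (1 - 2 * u + 2 * r - 2 * r / m)"
    and c3: "\<And>r. \<bar>r\<bar> \<le> \<eta> \<Longrightarrow>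
        0 \<le> (u - 3 + (p - 1) * r) * (u - 2 + (p - 1) * r) - \<rho> r * (p - 1)"
    and c4: "\<And>r. \<bar>r\<bar> \<le> \<eta> \<Longrightarrow> 2 powr u * (1 - u + r) \<le> 1"
    and c5: "\<And>r. \<bar>r\<bar> \<le> \<eta> \<Longrightarrow>
        lam \<le> (p - 1) * (1 - u + r) powr (p - 2) * (\<rho> r - (r - u) * (1 - u + r))"
  shows "hardy_const p n \<le> 1 / lam"
proof -
  let ?h = "log_trig m \<alpha> \<phi>" and ?r = "log_cot m \<alpha> \<phi>"
  let ?S = "\<lambda>x. sin (\<alpha> * ln x + \<phi>)"
  let ?P2 = "\<lambda>r. (- u + r) * (1 - u + r) - \<rho> r"
  let ?P3 = "\<lambda>r. (- u - 1 + r) * ?P2 r - \<rho> r * (1 - 2 * u + 2 * r - 2 * r / m)"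
  let ?Q1 = "\<lambda>r. u - 2 + (p - 1) * r"
  let ?Q2 = "\<lambda>r. (u - 3 + (p - 1) * r) * (u - 2 + (p - 1) * r) - \<rho> r * (p - 1)"
  have pos: "0 < x" and angle: "0 < \<alpha> * ln x + \<phi>" "\<alpha> * ln x + \<phi> < pi" if "x \<in> I" for x
  proof -
    show x: "0 < x" using that by (auto simp: I_def)
    have "\<alpha> * ln (1/2) \<le> \<alpha> * ln x" "\<alpha> * ln x \<le> \<alpha> * ln (real n + 1/2)"
      using that x \<alpha> by (auto simp: I_def simp del: mult_le_cancel_left_pos intro!: mult_left_mono)
    thus "0 < \<alpha> * ln x + \<phi>" "\<alpha> * ln x + \<phi> < pi" using left right by linarith+
  qed
  have S: "0 < ?S x" if "x \<in> I" for x using angle[OF that] by (rule sin_gt_zero)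
  have dF: "(?h (1 - u) 1 (\<lambda>_. 1) has_real_derivative ?h (- u) 1 (\<lambda>r. 1 - u + r) x) (at x)" if "x \<in> I" for x
    by (rule has_real_derivative_log_trig[OF m pos[OF that] S[OF that], where P' = "0"])
      (use m in \<open>auto intro!: derivative_eq_intros simp: \<rho>_def algebra_simps\<close>)
  have df: "(?h (- u) 1 (\<lambda>r. 1 - u + r) has_real_derivative ?h (- u - 1) 1 ?P2 x) (at x)" if "x \<in> I" for x
    by (rule has_real_derivative_log_trig[OF m pos[OF that] S[OF that], where P' = "1"])
      (use m in \<open>auto intro!: derivative_eq_intros simp: \<rho>_def algebra_simps\<close>)
  have ddf: "(?h (- u - 1) 1 ?P2 has_real_derivative ?h (- u - 2) 1 ?P3 x) (at x)" if "x \<in> I" for x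
    by (rule has_real_derivative_log_trig[OF m pos[OF that] S[OF that], where P' = "1 - 2 * u + 2 * ?r x - 2 * ?r x / m"])
      (use m in \<open>auto intro!: derivative_eq_intros simp: \<rho>_def algebra_simps\<close>)
  have dw: "(?h (u - 2) (p - 1) (\<lambda>_. 1) has_real_derivative ?h (u - 3) (p - 1) ?Q1 x) (at x)" if "x \<in> I" for x
    by (rule has_real_derivative_log_trig[OF m pos[OF that] S[OF that], where P' = "0"])
      (use m in \<open>auto intro!: derivative_eq_intros simp: \<rho>_def algebra_simps\<close>)
  have ddw: "(?h (u - 3) (p - 1) ?Q1 has_real_derivative ?h (u - 4) (p - 1) ?Q2 x) (at x)" if "x \<in> I" for x
    by (rule has_real_derivative_log_trig[OF m pos[OF that] S[OF that], where P' = "p - 1"])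
      (use m in \<open>auto intro!: derivative_eq_intros simp: \<rho>_def algebra_simps\<close>)
  have u: "u * p = 1" using p by (simp add: u_def)
  show ?thesis
  proof (rule hardy_const_le_of_convex_profile[OF _ n lam, of p "?h (1 - u) 1 (\<lambda>_. 1)" "?h (- u) 1 (\<lambda>r. 1 - u + r)"
      "?h (- u - 1) 1 ?P2" "?h (u - 2) (p - 1) (\<lambda>_. 1)" "?h (u - 3) (p - 1) ?Q1"], unfold I_def[symmetric])
    show "1 < p" using p by simp
    show "convex_on I (?h (- u) 1 (\<lambda>r. 1 - u + r))"
    proof (rule f''_ge0_imp_convex[OF _ df ddf])
      show "convex I" by (simp add: I_def)
      show "0 \<le> ?h (- u - 2) 1 ?P3 x" if "x \<in> I" for x
        unfolding log_trig_def by (intro mult_nonneg_nonneg c2 r that) auto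
    qed
    show "convex_on I (?h (u - 2) (p - 1) (\<lambda>_. 1))"
    proof (rule f''_ge0_imp_convex[OF _ dw ddw])
      show "convex I" by (simp add: I_def)
      show "0 \<le> ?h (u - 4) (p - 1) ?Q2 x" if "x \<in> I" for x
        unfolding log_trig_def by (intro mult_nonneg_nonneg c3 r that) auto
    qed
    show "0 < ?h (- u) 1 (\<lambda>r. 1 - u + r) x" if "x \<in> I" for x
      unfolding log_trig_def using S[OF that] pos[OF that] c1[OF r[OF that]] by simp
    show "?h (- u) 1 (\<lambda>r. 1 - u + r) (1/2) \<le> ?h (1 - u) 1 (\<lambda>_. 1) 1"
    proof -
      have half: "1/2 \<in> I" and one: "1 \<in> I" using n by (auto simp: I_def)
      have "ln (1/2 :: real) \<le> 0" by simp
      hence "\<alpha> * ln (1/2) \<le> 0" using \<alpha> by (intro mult_nonneg_nonpos) auto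
      hence "?S (1/2) \<le> ?S 1" using left \<phi> pi_gt_zero
        by (intro sin_monotone_2pi_le) auto
      hence "?S (1/2) powr m \<le> ?S 1 powr m" using S[OF half] m by (intro powr_mono2) auto
      moreover have "2 powr u * (1 - u + ?r (1/2)) \<le> 1" by (intro c4 r half)
      ultimately have "?S (1/2) powr m * (2 powr u * (1 - u + ?r (1/2))) \<le> ?S 1 powr m * 1"
        using c1[OF r[OF half]] by (intro mult_mono) auto
      moreover have "(1/2 :: real) powr (- u) = 2 powr u"
        by (simp add: powr_divide powr_minus_divide)
      ultimately show ?thesis by (simp add: log_trig_def mult_ac)
    qed
    show "?h (u - 2) (p - 1) (\<lambda>_. 1) x = x powr (- p) * ?h (1 - u) 1 (\<lambda>_. 1) x powr (p - 1)" if "x \<in> I" for x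
    proof -
      have e: "u - 2 = - p + (1 - u) * (p - 1)" using u by (simp add: algebra_simps)
      show ?thesis unfolding log_trig_def e powr_add using pos[OF that] S[OF that]
        by (simp add: powr_mult powr_powr)
    qed
    show "lam * ?h (u - 2) (p - 1) (\<lambda>_. 1) x
        \<le> - ((p - 1) * ?h (- u) 1 (\<lambda>r. 1 - u + r) x powr (p - 2) * ?h (- u - 1) 1 ?P2 x)" if "x \<in> I" for x
    proof -
      have x: "0 < x" and Sx: "0 < ?S x" and r1: "0 < 1 - u + ?r x"
        using pos S c1 r that by auto
      have e: "u - 2 = - u * (p - 2) + (- u - 1)" using u by (simp add: algebra_simps)
      have e': "m * (p - 1) = m * (p - 2) + m" by (simp add: algebra_simps)
      define A where "A = 1 - u + ?r x"
      have A: "0 < A" using r1 by (simp add: A_def)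
      have P2: "?P2 (?r x) = - (\<rho> (?r x) - (?r x - u) * A)" by (simp add: A_def algebra_simps)
      have "lam * ?h (u - 2) (p - 1) (\<lambda>_. 1) x = (x powr (u - 2) * ?S x powr (m * (p - 1))) * lam"
        by (simp add: log_trig_def)
      also have "\<dots> \<le> (x powr (u - 2) * ?S x powr (m * (p - 1))) *
          ((p - 1) * A powr (p - 2) * (\<rho> (?r x) - (?r x - u) * A))"
        unfolding A_def by (intro mult_left_mono c5 r that) auto
      also have "\<dots> = - ((p - 1) * ?h (- u) 1 (\<lambda>r. 1 - u + r) x powr (p - 2) * ?h (- u - 1) 1 ?P2 x)"
        unfolding log_trig_def e e' powr_add P2 A_def[symmetric] using x Sx A
        by (simp add: powr_mult powr_powr) (simp add: algebra_simps)
      finally show ?thesis .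
    qed
  qed (use dF df dw in auto)
qed

section \<open>The supersolution condition\<close>

text \<open>At \<open>r = \<alpha> = 0\<close>, which is the pure power \<open>x powr (1 - 1 / p)\<close>, the conditions \<open>c2\<close>, \<open>c3\<close>, \<open>c4\<close> hold strictly,
  hence they persist near \<open>0\<close>. For the last one, strictness at \<open>0\<close> is
  \<open>2 < (p / (p - 1)) powr p\<close>, a case of Bernoulli's inequality.\<close>

lemma slope_window:
  fixes u m :: real
  assumes p: "2 \<le> p" and u: "u = 1 / p" and m: "0 < m"
  shows "\<exists>\<eta>>0. \<forall>r \<alpha>. \<bar>r\<bar> \<le> \<eta> \<longrightarrow> \<bar>\<alpha>\<bar> \<le> \<eta> \<longrightarrow>
      0 \<le> (- u - 1 + r) * ((- u + r) * (1 - u + r) - (m * \<alpha>\<^sup>2 + r\<^sup>2 / m))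
           - (m * \<alpha>\<^sup>2 + r\<^sup>2 / m) * (1 - 2 * u + 2 * r - 2 * r / m) \<and>
      0 \<le> (u - 3 + (p - 1) * r) * (u - 2 + (p - 1) * r) - (m * \<alpha>\<^sup>2 + r\<^sup>2 / m) * (p - 1) \<and>
      2 powr u * (1 - u + r) \<le> 1"
proof -
  have u01: "0 < u" "u < 1" using p by (auto simp: u)
  define g1 where "g1 z = (- u - 1 + fst z) * ((- u + fst z) * (1 - u + fst z) - (m * (snd z)\<^sup>2 + (fst z)\<^sup>2 / m))
           - (m * (snd z)\<^sup>2 + (fst z)\<^sup>2 / m) * (1 - 2 * u + 2 * fst z - 2 * fst z / m)" for z
  define g2 where "g2 z = (u - 3 + (p - 1) * fst z) * (u - 2 + (p - 1) * fst z)
           - (m * (snd z)\<^sup>2 + (fst z)\<^sup>2 / m) * (p - 1)" for z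
  define g3 where "g3 z = 1 - 2 powr u * (1 - u + fst z)" for z :: "real \<times> real"
  have cont: "isCont g1 (0, 0)" "isCont g2 (0, 0)" "isCont g3 (0, 0)"
    unfolding g1_def g2_def g3_def by (auto intro!: continuous_intros simp: m less_imp_neq[symmetric])
  have "0 < (u + 1) * u * (1 - u)" using u01 by simp
  hence "0 < g1 (0, 0)" by (simp add: g1_def algebra_simps)
  moreover have "0 < g2 (0, 0)" using u01 by (simp add: g2_def mult_neg_neg)
  moreover have "0 < g3 (0, 0)"
  proof -
    define q where "q = p / (p - 1)"
    have q: "0 < q" using p by (simp add: q_def)
    have "1 powr p + p * 1 powr (p - 1) * (q - 1) \<le> q powr p"
      using p q by (intro powr_ge_tangent) auto
    moreover have "p * (q - 1) = q" using p by (simp add: q_def field_simps)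
    moreover have "1 < q" using p by (simp add: q_def)
    ultimately have "2 < q powr p" by simp
    hence "2 powr u < (q powr p) powr u" using u01 by (intro powr_less_mono2) auto
    also have "\<dots> = q" using q p by (simp add: powr_powr u)
    finally have "2 powr u * (1 - u) < q * (1 - u)" using u01 by simp
    also have "q * (1 - u) = 1" using p by (simp add: q_def u field_simps)
    finally show ?thesis by (simp add: g3_def)
  qed
  ultimately have "\<forall>\<^sub>F z in nhds (0, 0). 0 < g1 z \<and> 0 < g2 z \<and> 0 < g3 z"
    using cont by (intro eventually_conj)
      (auto simp: continuous_at tendsto_at_iff_tendsto_nhds intro: order_tendstoD(1))
  then obtain d where d: "0 < d" "\<And>z. dist z (0, 0) < d \<Longrightarrow> 0 < g1 z \<and> 0 < g2 z \<and> 0 < g3 z"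
    unfolding eventually_nhds_metric by blast
  show ?thesis
  proof (intro exI[of _ "d / 3"] conjI allI impI)
    show "0 < d / 3" using d by simp
    fix r \<alpha> :: real assume *: "\<bar>r\<bar> \<le> d / 3" "\<bar>\<alpha>\<bar> \<le> d / 3"
    have "dist (r, \<alpha>) (0, 0) \<le> \<bar>r\<bar> + \<bar>\<alpha>\<bar>"
      using sqrt_sum_squares_le_sum_abs[of r \<alpha>] by (simp add: dist_Pair_Pair)
    also have "\<dots> < d" using * d(1) by linarith
    finally have "0 < g1 (r, \<alpha>) \<and> 0 < g2 (r, \<alpha>) \<and> 0 < g3 (r, \<alpha>)" by (rule d(2))
    thus "0 \<le> (- u - 1 + r) * ((- u + r) * (1 - u + r) - (m * \<alpha>\<^sup>2 + r\<^sup>2 / m))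
           - (m * \<alpha>\<^sup>2 + r\<^sup>2 / m) * (1 - 2 * u + 2 * r - 2 * r / m)"
      "0 \<le> (u - 3 + (p - 1) * r) * (u - 2 + (p - 1) * r) - (m * \<alpha>\<^sup>2 + r\<^sup>2 / m) * (p - 1)"
      "2 powr u * (1 - u + r) \<le> 1"
      by (auto simp: g1_def g2_def g3_def)
  qed
qed

text \<open>The condition \<open>c5\<close> is an equality at \<open>r = \<alpha> = 0\<close>, so continuity does not suffice. In terms of
  \<open>y = r / (1 - u)\<close> and after division by \<open>(1 - u) powr p\<close> it bounds from below
  \<open>(1 + y) powr (p - 1) * (1 - (p - 1) * y)\<close> plus the Riccati term. By Bernoulli this product
  is at least \<open>1 - (p - 1)\<^sup>2 * y\<^sup>2\<close>; the exponent \<open>m\<close> is chosen such that the part of the Riccati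
  term that is quadratic in \<open>y\<close> compensates exactly this loss, and the part with \<open>\<alpha>\<^sup>2\<close> is the gain.
  The factor \<open>\<sigma>\<close> is a lower bound for \<open>(1 + y) powr (p - 2)\<close>. For \<open>p = 2\<close> one has \<open>\<sigma> = m = 1\<close> and
  equality throughout, which is why the constant is then exact.\<close>

lemma riccati_lower_bound:
  fixes p :: real
  assumes p: "2 \<le> p" and r: "\<bar>r\<bar> \<le> (1 - 1 / p) / p"
  defines "u \<equiv> 1 / p" and "\<sigma> \<equiv> (1 / 2) powr (p - 2)"
  defines "m \<equiv> \<sigma> / (p - 1)"
  shows "(1 - u) powr p * (1 + (\<sigma> / (1 - u))\<^sup>2 * \<alpha>\<^sup>2)
      \<le> (p - 1) * (1 - u + r) powr (p - 2) * (m * \<alpha>\<^sup>2 + r\<^sup>2 / m - (r - u) * (1 - u + r))"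
proof -
  define U where "U = 1 - u"
  define y where "y = r / U"
  define \<rho> where "\<rho> = m * \<alpha>\<^sup>2 + r\<^sup>2 / m"
  have U: "0 < U" and pu: "(p - 1) * u = U"
    using p unfolding U_def u_def by (simp_all add: field_simps)
  have \<sigma>: "0 < \<sigma>" by (simp add: \<sigma>_def)
  have m: "0 < m" using p \<sigma> by (simp add: m_def)
  have \<rho>: "0 \<le> \<rho>" using m by (simp add: \<rho>_def)
  have r_eq: "r = U * y" using U by (simp add: y_def)
  have "\<bar>y\<bar> \<le> 1 / p"
    using r U p by (simp add: y_def U_def u_def abs_divide divide_le_eq mult.commute)
  moreover have "1 / p \<le> 1 / 2" using p by (intro divide_left_mono) auto
  moreover have "(p - 1) * y \<le> (p - 1) * (1 / p)"
    using calculation(1) p by (intro mult_left_mono) auto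
  moreover have "(p - 1) * (1 / p) \<le> 1" using p by (simp add: field_simps)
  ultimately have y: "1 / 2 \<le> 1 + y" and py: "(p - 1) * y \<le> 1" by linarith+
  have s2: "\<sigma> \<le> (1 + y) powr (p - 2)"
    unfolding \<sigma>_def using y p by (intro powr_mono2) auto
  have "1 powr (p - 1) + (p - 1) * 1 powr (p - 1 - 1) * (1 + y - 1) \<le> (1 + y) powr (p - 1)"
    using y p by (intro powr_ge_tangent) auto
  hence s1: "1 + (p - 1) * y \<le> (1 + y) powr (p - 1)" by simp
  have "U\<^sup>2 * (1 + (\<sigma> / U)\<^sup>2 * \<alpha>\<^sup>2) = (p - 1) * (\<sigma> * \<rho>) + U\<^sup>2 * ((1 + (p - 1) * y) * (1 - (p - 1) * y))"
    using p U \<sigma> by (simp add: \<rho>_def m_def r_eq power2_eq_square field_simps)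
  also have "\<dots> \<le> (p - 1) * ((1 + y) powr (p - 2) * \<rho>) + U\<^sup>2 * ((1 + y) powr (p - 1) * (1 - (p - 1) * y))"
    using p \<rho> s2 s1 py by (intro add_mono mult_left_mono mult_right_mono) auto
  also have "\<dots> = (p - 1) * (1 + y) powr (p - 2) * (\<rho> - (r - u) * (U * (1 + y)))"
  proof -
    define W Z c where "W = (1 + y) powr (p - 2)" and "Z = (r - u) * (U * (1 + y))"
      and "c = (1 + y) * (1 - (p - 1) * y)"
    have "(1 + y) powr (p - 1) = (1 + y) * W"
      using powr_mult_base[of "1 + y" "p - 2"] y by (simp add: W_def algebra_simps)
    hence W: "(1 + y) powr (p - 1) * (1 - (p - 1) * y) = W * c" by (simp add: c_def)
    have "(p - 1) * (r - u) = - U * (1 - (p - 1) * y)"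
      unfolding right_diff_distrib pu unfolding r_eq by (simp add: algebra_simps)
    hence Z: "(p - 1) * Z = - U\<^sup>2 * c"
      by (simp add: Z_def c_def power2_eq_square mult.assoc[symmetric])
    have "(p - 1) * W * (\<rho> - Z) = (p - 1) * (W * \<rho>) - W * ((p - 1) * Z)"
      by (simp add: algebra_simps)
    thus ?thesis unfolding W Z W_def[symmetric] Z_def[symmetric] by simp
  qed
  finally have *: "U\<^sup>2 * (1 + (\<sigma> / U)\<^sup>2 * \<alpha>\<^sup>2)
      \<le> (p - 1) * (1 + y) powr (p - 2) * (\<rho> - (r - u) * (U * (1 + y)))" .
  have "U powr p * (1 + (\<sigma> / U)\<^sup>2 * \<alpha>\<^sup>2) = U powr (p - 2) * (U\<^sup>2 * (1 + (\<sigma> / U)\<^sup>2 * \<alpha>\<^sup>2))"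
    using U by (simp add: powr_diff)
  also have "\<dots> \<le> U powr (p - 2) * ((p - 1) * (1 + y) powr (p - 2) * (\<rho> - (r - u) * (U * (1 + y))))"
    by (intro mult_left_mono *) auto
  also have "\<dots> = (p - 1) * (U * (1 + y)) powr (p - 2) * (\<rho> - (r - u) * (U * (1 + y)))"
    using U y by (simp add: powr_mult)
  also have "U * (1 + y) = 1 - u + r" by (simp add: r_eq U_def algebra_simps)
  finally show ?thesis by (simp add: U_def \<rho>_def)
qed

text \<open>Keeping the phase at distance \<open>c * \<alpha>\<close> from \<open>0\<close> and \<open>pi\<close> bounds \<^const>\<open>log_cot\<close> uniformly in
  \<open>\<alpha>\<close>, because \<open>cot \<delta> \<le> 1 / \<delta>\<close>. In the variable \<open>ln x\<close> this distance is the constant \<open>c\<close>, so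
  asymptotically it costs nothing.\<close>

lemma abs_log_cot_le:
  assumes "0 < m" "0 < \<alpha>" "0 < c" "c * \<alpha> < pi / 2"
    and "c * \<alpha> \<le> \<alpha> * ln x + \<phi>" "\<alpha> * ln x + \<phi> \<le> pi - c * \<alpha>"
  shows "\<bar>log_cot m \<alpha> \<phi> x\<bar> \<le> m / c"
proof -
  \<comment> \<open>Among the admissible phases \<open>\<theta>\<close>, the cotangent is largest in absolute value at \<open>\<delta>\<close> and \<open>pi - \<delta>\<close>.\<close>
  define \<delta> \<theta> where "\<delta> = c * \<alpha>" and "\<theta> = \<alpha> * ln x + \<phi>"
  have \<delta>: "0 < \<delta>" "\<delta> < pi / 2" and \<theta>: "\<delta> \<le> \<theta>" "\<theta> \<le> pi - \<delta>"
    using assms by (auto simp: \<delta>_def \<theta>_def)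
  have "cos \<theta> \<le> cos \<delta>" using \<delta> \<theta> by (intro cos_monotone_0_pi_le) auto
  moreover have "cos (pi - \<delta>) \<le> cos \<theta>" using \<delta> \<theta> by (intro cos_monotone_0_pi_le) auto
  ultimately have cos: "\<bar>cos \<theta>\<bar> \<le> cos \<delta>" by simp
  have s: "0 < sin \<theta>" "0 < sin \<delta>" using \<delta> \<theta> by (auto intro!: sin_gt_zero)
  have "(sin \<delta>)\<^sup>2 \<le> (sin \<theta>)\<^sup>2"
    using power_mono[OF cos, of 2] by (simp add: sin_squared_eq)
  hence "sin \<delta> \<le> sin \<theta>" using s by (simp add: power2_le_iff_abs_le abs_le_square_iff[symmetric])
  hence "\<bar>cot \<theta>\<bar> \<le> cos \<delta> / sin \<delta>"
    unfolding cot_def abs_divide using cos s by (intro frac_le) auto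
  also have "\<dots> \<le> 1 / \<delta>"
  proof -
    have "\<delta> - 0 \<le> tan \<delta> - tan 0"
    proof (rule increment_mono[where g' = "\<lambda>_. 1"])
      fix x :: real assume "0 \<le> x" "x \<le> \<delta>"
      hence cos_x: "0 < cos x" using \<delta> by (intro cos_gt_zero_pi) auto
      thus "(tan has_real_derivative inverse ((cos x)\<^sup>2)) (at x)" by simp
      show "1 \<le> inverse ((cos x)\<^sup>2)"
        using cos_x by (intro one_le_inverse) (auto simp: abs_square_le_1)
    qed (use \<delta> in \<open>auto intro!: derivative_eq_intros\<close>)
    thus ?thesis using \<delta> s cos_gt_zero[of \<delta>] by (simp add: tan_def field_simps)
  qed
  finally have "(m * \<alpha>) * \<bar>cot \<theta>\<bar> \<le> (m * \<alpha>) * (1 / \<delta>)"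
    using assms by (intro mult_left_mono) auto
  thus ?thesis using assms by (simp add: log_cot_def \<theta>_def \<delta>_def abs_mult)
qed

section \<open>Estimates for the Hardy constant\<close>

text \<open>The phase \<open>\<alpha> * ln x + \<phi>\<close> has to stay in \<open>{c * \<alpha>..pi - c * \<alpha>}\<close> while \<open>x\<close> runs through
  \<open>{1/2..n + 1/2}\<close>; this allows \<open>\<alpha>\<close> asymptotic to \<open>pi / ln n\<close>. The minorant \<open>g\<close> is the gain
  from \<open>riccati_lower_bound\<close> for this \<open>\<alpha>\<close>, multiplied by \<open>(ln n)\<^sup>2\<close>. For \<open>p = 2\<close> its limit is
  \<open>16 * pi\<^sup>2\<close>, the constant of the lower estimate.\<close>

lemma hardy_const_gap_eventually:
  fixes p :: real
  assumes p: "2 \<le> p"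
  defines "K \<equiv> (p / (p - 1)) powr p * (p / (p - 1) * (1 / 2) powr (p - 2) * pi)\<^sup>2"
  shows "\<exists>g. g \<longlonglongrightarrow> K \<and>
    (\<forall>\<^sub>F n in sequentially. g n \<le> (ln (real n))\<^sup>2 * ((p / (p - 1)) powr p - hardy_const p n))"
proof -
  define u where "u = 1 / p"
  define \<sigma> where "\<sigma> = (1 / 2 :: real) powr (p - 2)"
  define m where "m = \<sigma> / (p - 1)"
  define \<tau> where "\<tau> = \<sigma> / (1 - u)"
  have U: "0 < 1 - u" and q: "p / (p - 1) = 1 / (1 - u)" using p by (auto simp: u_def field_simps)
  have m: "0 < m" using p by (simp add: m_def \<sigma>_def)
  obtain \<eta>' where \<eta>': "0 < \<eta>'" and w: "\<And>r \<alpha>. \<bar>r\<bar> \<le> \<eta>' \<Longrightarrow> \<bar>\<alpha>\<bar> \<le> \<eta>' \<Longrightarrow>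
      0 \<le> (- u - 1 + r) * ((- u + r) * (1 - u + r) - (m * \<alpha>\<^sup>2 + r\<^sup>2 / m))
           - (m * \<alpha>\<^sup>2 + r\<^sup>2 / m) * (1 - 2 * u + 2 * r - 2 * r / m) \<and>
      0 \<le> (u - 3 + (p - 1) * r) * (u - 2 + (p - 1) * r) - (m * \<alpha>\<^sup>2 + r\<^sup>2 / m) * (p - 1) \<and>
      2 powr u * (1 - u + r) \<le> 1"
    using slope_window[OF p u_def m] by blast
  define \<eta> where "\<eta> = min \<eta>' ((1 - u) / p)"
  have \<eta>: "0 < \<eta>" "\<eta> \<le> \<eta>'" "\<eta> \<le> (1 - u) / p" using \<eta>' U p by (auto simp: \<eta>_def)
  have "(1 - u) * 1 < (1 - u) * p" using U p by (intro mult_strict_left_mono) auto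
  hence "(1 - u) / p < 1 - u" using p by (simp add: pos_divide_less_eq)
  hence \<eta>_less: "\<eta> < 1 - u" using \<eta> by linarith
  \<comment> \<open>With this \<open>c\<close> the bound \<open>m / c\<close> for \<^const>\<open>log_cot\<close> is exactly \<open>\<eta>\<close>.\<close>
  define c where "c = m / \<eta>"
  have c: "0 < c" using m \<eta> by (simp add: c_def)
  \<comment> \<open>As \<open>- 1 \<le> ln (1/2)\<close> and \<open>ln (n + 1/2) \<le> ln n + 1\<close>, the logarithm stays in an interval of length
    \<open>ln n + 2\<close>; the term \<open>2 * c\<close> is the margin at both ends of \<open>{0..pi}\<close>.\<close>
  define \<alpha> where "\<alpha> n = pi / (ln (real n) + 2 + 2 * c)" for n :: nat
  define lam where "lam n = (1 - u) powr p * (1 + \<tau>\<^sup>2 * (\<alpha> n)\<^sup>2)" for n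
  have lim: "\<alpha> \<longlonglongrightarrow> 0" "(\<lambda>n. ln (real n) * \<alpha> n) \<longlonglongrightarrow> pi"
    unfolding \<alpha>_def by real_asymp+
  have bound: "hardy_const p n \<le> 1 / lam n" if n: "1 \<le> n" and small: "\<alpha> n \<le> \<eta>" for n
  proof -
    define \<phi> where "\<phi> = \<alpha> n * (1 + c)"
    have ln: "0 \<le> ln (real n)" using n by simp
    have D: "0 < ln (real n) + 2 + 2 * c" using ln c by linarith
    have \<alpha>: "0 < \<alpha> n" using D by (simp add: \<alpha>_def)
    have total: "\<alpha> n * (ln (real n) + 2 + 2 * c) = pi" using D by (simp add: \<alpha>_def)
    have angle: "c * \<alpha> n \<le> \<alpha> n * ln x + \<phi>" "\<alpha> n * ln x + \<phi> \<le> pi - c * \<alpha> n"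
      if x: "x \<in> {1/2..real n + 1/2}" for x
    proof -
      have "ln (1/2) \<le> ln x" using x by simp
      moreover have "- 1 \<le> ln (1/2 :: real)" using ln2_le_25_over_36 by (simp add: ln_div)
      ultimately have "- 1 \<le> ln x" by linarith
      hence "\<alpha> n * (- 1) \<le> \<alpha> n * ln x" using \<alpha> by (intro mult_left_mono) auto
      thus "c * \<alpha> n \<le> \<alpha> n * ln x + \<phi>" by (simp add: \<phi>_def algebra_simps)
      have "ln x \<le> ln (2 * real n)" using x n by simp
      also have "\<dots> \<le> ln (real n) + 1" using ln2_le_25_over_36 n by (simp add: ln_mult)
      finally have "\<alpha> n * ln x \<le> \<alpha> n * (ln (real n) + 1)" using \<alpha> by (intro mult_left_mono) auto
      thus "\<alpha> n * ln x + \<phi> \<le> pi - c * \<alpha> n"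
        using total by (simp add: \<phi>_def algebra_simps)
    qed
    have c\<alpha>: "0 < c * \<alpha> n" using c \<alpha> by simp
    have \<phi>_le: "\<phi> \<le> pi / 2"
      using total mult_nonneg_nonneg[OF less_imp_le[OF \<alpha>] ln] by (simp add: \<phi>_def algebra_simps)
    have c\<alpha>_less: "c * \<alpha> n < pi / 2" using \<phi>_le \<alpha> by (simp add: \<phi>_def algebra_simps)
    show ?thesis
    proof (rule hardy_const_le_of_log_trig[OF p m n, of "lam n" "\<alpha> n" \<phi> \<eta>], unfold u_def[symmetric])
      show "0 < lam n" unfolding lam_def using U by (intro mult_pos_pos add_pos_nonneg) auto
      show "0 < \<alpha> n" "\<phi> \<le> pi / 2" by fact+
      show "0 < \<alpha> n * ln (1/2) + \<phi>" using angle(1)[of "1/2"] c\<alpha> by force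
      show "\<alpha> n * ln (real n + 1/2) + \<phi> < pi" using angle(2)[of "real n + 1/2"] c\<alpha> by force
      show "\<bar>log_cot m (\<alpha> n) \<phi> x\<bar> \<le> \<eta>" if "x \<in> {1/2..real n + 1/2}" for x
        using abs_log_cot_le[OF m \<alpha> c c\<alpha>_less angle[OF that]] m \<eta>(1) by (simp add: c_def)
      fix r :: real assume r: "\<bar>r\<bar> \<le> \<eta>"
      show "0 < 1 - u + r" using r \<eta>_less by linarith
      have "\<bar>r\<bar> \<le> \<eta>'" "\<bar>\<alpha> n\<bar> \<le> \<eta>'" using r small \<alpha> \<eta>(2) by auto
      note win = w[OF this]
      show "0 \<le> (- u - 1 + r) * ((- u + r) * (1 - u + r) - (m * (\<alpha> n)\<^sup>2 + r\<^sup>2 / m))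
           - (m * (\<alpha> n)\<^sup>2 + r\<^sup>2 / m) * (1 - 2 * u + 2 * r - 2 * r / m)"
        "0 \<le> (u - 3 + (p - 1) * r) * (u - 2 + (p - 1) * r) - (m * (\<alpha> n)\<^sup>2 + r\<^sup>2 / m) * (p - 1)"
        "2 powr u * (1 - u + r) \<le> 1" using win by blast+
      show "lam n \<le> (p - 1) * (1 - u + r) powr (p - 2) * (m * (\<alpha> n)\<^sup>2 + r\<^sup>2 / m - (r - u) * (1 - u + r))"
        using riccati_lower_bound[OF p, of r "\<alpha> n"] r \<eta>(3)
        by (simp add: lam_def \<tau>_def m_def \<sigma>_def u_def)
    qed
  qed
  define Q where "Q = (p / (p - 1)) powr p"
  define g where "g n = Q * \<tau>\<^sup>2 * (ln (real n) * \<alpha> n)\<^sup>2 / (1 + \<tau>\<^sup>2 * (\<alpha> n)\<^sup>2)" for n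
  have "g \<longlonglongrightarrow> Q * \<tau>\<^sup>2 * pi\<^sup>2 / (1 + \<tau>\<^sup>2 * 0\<^sup>2)"
    unfolding g_def by (intro tendsto_intros lim) auto
  also have "Q * \<tau>\<^sup>2 * pi\<^sup>2 / (1 + \<tau>\<^sup>2 * 0\<^sup>2) = K"
    unfolding K_def Q_def \<tau>_def \<sigma>_def q by (simp add: power_mult_distrib power_divide)
  finally have "g \<longlonglongrightarrow> K" .
  moreover have "\<forall>\<^sub>F n in sequentially. g n \<le> (ln (real n))\<^sup>2 * (Q - hardy_const p n)"
    using eventually_ge_at_top[of 1] order_tendstoD(2)[OF lim(1) \<eta>(1)]
  proof eventually_elim
    case (elim n)
    define t where "t = \<tau>\<^sup>2 * (\<alpha> n)\<^sup>2"
    have t: "0 < 1 + t" unfolding t_def by (intro add_pos_nonneg) auto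
    have "1 / lam n = Q / (1 + t)"
      using U by (simp add: lam_def t_def Q_def q powr_divide)
    hence "hardy_const p n \<le> Q / (1 + t)" using bound[of n] elim by simp
    hence "Q - Q / (1 + t) \<le> Q - hardy_const p n" by simp
    hence "(ln (real n))\<^sup>2 * (Q - Q / (1 + t)) \<le> (ln (real n))\<^sup>2 * (Q - hardy_const p n)"
      by (intro mult_left_mono) auto
    moreover have "Q - Q / (1 + t) = Q * t / (1 + t)" using t by (simp add: field_simps)
    ultimately show ?case by (simp add: g_def t_def power_mult_distrib mult_ac)
  qed
  ultimately show ?thesis unfolding Q_def by blast
qed

theorem theorem1p6:
  fixes p :: real
  assumes "2 \<le> p"
  shows "\<exists>c3 c4 :: real. 0 < c3 \<and> 0 < c4 \<and>
      (\<forall>n\<ge>2.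
         (p / (p - 1)) powr p - c3 / (ln (real n))\<^sup>2 \<le> hardy_const p n \<and>
         hardy_const p n \<le> (p / (p - 1)) powr p - c4 / (ln (real n))\<^sup>2) \<and>
      (\<forall>n\<ge>2.
         (\<exists>!\<alpha>. alpha_eq p n \<alpha>) \<and>
         (\<forall>\<alpha>. alpha_eq p n \<alpha> \<longrightarrow>
            (\<Sum>k=1..n. ((1 / real k) * (\<Sum>j=1..k. astar p \<alpha> j)) powr p)
              \<ge> ((p / (p - 1)) powr p - c3 / (ln (real n))\<^sup>2) * (\<Sum>k=1..n. astar p \<alpha> k powr p))) \<and>
      c3 \<le> (p / (p - 1)) powr (p + 1) * p * pi\<^sup>2 \<and>
      (p = 2 \<longrightarrow>
         (\<lambda>n. (ln (real n))\<^sup>2 * ((p / (p - 1)) powr p - hardy_const p n))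
           \<longlonglongrightarrow> (p / (p - 1)) powr (p + 1) * p * pi\<^sup>2)"
proof -
  define Q where "Q = (p / (p - 1)) powr p"
  define c3 where "c3 = (p / (p - 1)) powr (p + 1) * p * pi\<^sup>2"
  define K where "K = (p / (p - 1)) powr p * (p / (p - 1) * (1 / 2) powr (p - 2) * pi)\<^sup>2"
  have p: "2 \<le> p" by fact
  have c3: "0 < c3" using p by (simp add: c3_def)
  have K: "0 < K" using p by (simp add: K_def)
  have lower: "Q - c3 / (ln (real n))\<^sup>2 \<le> hardy_const p n" if n: "2 \<le> n" for n
  proof -
    obtain \<alpha> where \<alpha>: "alpha_eq p n \<alpha>" using alpha_eq_unique_solution[of p n] p n by auto
    have n1: "1 < p" "1 \<le> n" "0 < p" using p n by auto
    have "(Q - c3 / (ln (real n))\<^sup>2) * (\<Sum>k=1..n. astar p \<alpha> k powr p)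
        \<le> hardy_const p n * (\<Sum>k=1..n. astar p \<alpha> k powr p)"
      using astar_almost_extremal[OF p n \<alpha>] hardy_const_least(1)[OF n1(3,2)]
        astar_hardy_ratio(1)[OF n1(1,2) \<alpha>]
      unfolding finite_hardy_def Q_def c3_def by (blast intro: order_trans)
    thus ?thesis using astar_hardy_ratio(2)[OF n1(1,2) \<alpha>] by simp
  qed
  obtain g where g: "g \<longlonglongrightarrow> K"
    "\<forall>\<^sub>F n in sequentially. g n \<le> (ln (real n))\<^sup>2 * (Q - hardy_const p n)"
    using hardy_const_gap_eventually[OF p] unfolding K_def Q_def by blast
  have "\<forall>\<^sub>F n in sequentially. K / 2 \<le> (ln (real n))\<^sup>2 * (Q - hardy_const p n)"
    using order_tendstoD(1)[OF g(1), of "K / 2"] g(2) K by (auto elim: eventually_elim2)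
  then obtain N where N: "\<And>n. N \<le> n \<Longrightarrow> K / 2 \<le> (ln (real n))\<^sup>2 * (Q - hardy_const p n)"
    by (auto simp: eventually_sequentially)
  define M where "M = max N 2"
  have M: "2 \<le> M" "N \<le> M" by (auto simp: M_def)
  \<comment> \<open>The bound holds from \<open>M\<close> on. For \<open>n < M\<close> the deficit is at least the one at \<open>M\<close>, and
    \<open>ln n \<ge> ln 2\<close> converts it.\<close>
  define c4 where "c4 = K / 2 * (ln 2 / ln (real M))\<^sup>2"
  have lnM: "ln 2 \<le> ln (real M)" "0 < ln (real M)" using M by auto
  have c4: "0 < c4" using K lnM by (simp add: c4_def)
  have upper: "hardy_const p n \<le> Q - c4 / (ln (real n))\<^sup>2" if n: "2 \<le> n" for n
  proof -
    have ln: "ln 2 \<le> ln (real n)" "0 < ln (real n)" using n by auto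
    have gap: "K / 2 / (ln (real k))\<^sup>2 \<le> Q - hardy_const p k" if "M \<le> k" for k
      using N[of k] M that by (simp add: divide_le_eq mult.commute)
    have "c4 / (ln (real n))\<^sup>2 \<le> Q - hardy_const p n"
    proof (cases "M \<le> n")
      case True
      have "(ln 2 / ln (real M))\<^sup>2 \<le> 1\<^sup>2" using lnM by (intro power_mono) auto
      hence "c4 \<le> K / 2" using K mult_left_mono[of "(ln 2 / ln (real M))\<^sup>2" 1 "K / 2"] by (simp add: c4_def)
      hence "c4 / (ln (real n))\<^sup>2 \<le> K / 2 / (ln (real n))\<^sup>2" by (intro divide_right_mono) auto
      thus ?thesis using gap[OF True] by linarith
    next
      case False
      have "(ln 2 / ln (real n))\<^sup>2 \<le> 1\<^sup>2" using ln by (intro power_mono) auto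
      hence "K / 2 / (ln (real M))\<^sup>2 * (ln 2 / ln (real n))\<^sup>2 \<le> K / 2 / (ln (real M))\<^sup>2"
        using K mult_left_mono[of "(ln 2 / ln (real n))\<^sup>2" 1 "K / 2 / (ln (real M))\<^sup>2"] by simp
      also have "\<dots> \<le> Q - hardy_const p M" by (rule gap) simp
      also have "\<dots> \<le> Q - hardy_const p n" using hardy_const_mono[of p n M] p n False by simp
      finally show ?thesis by (simp add: c4_def power_divide)
    qed
    thus ?thesis by simp
  qed
  have sharp: "(\<lambda>n. (ln (real n))\<^sup>2 * (Q - hardy_const p n)) \<longlonglongrightarrow> c3" if "p = 2"
  proof (rule tendsto_sandwich[OF g(2) _ _ tendsto_const])
    show "\<forall>\<^sub>F n in sequentially. (ln (real n))\<^sup>2 * (Q - hardy_const p n) \<le> c3"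
      using eventually_ge_at_top[of 2]
    proof eventually_elim
      case (elim n)
      have "Q - hardy_const p n \<le> c3 / (ln (real n))\<^sup>2" using lower[OF elim] by simp
      thus ?case using elim by (simp add: le_divide_eq mult.commute)
    qed
    show "g \<longlonglongrightarrow> c3" using g(1) that by (simp add: K_def c3_def power_mult_distrib)
  qed
  show ?thesis
  proof (rule exI[of _ c3], rule exI[of _ c4], fold Q_def c3_def, intro conjI allI impI)
    fix n :: nat assume n: "2 \<le> n"
    show "\<exists>!\<alpha>. alpha_eq p n \<alpha>" using alpha_eq_unique_solution p n by simp
    show "(Q - c3 / (ln (real n))\<^sup>2) * (\<Sum>k=1..n. astar p \<alpha> k powr p)
        \<le> (\<Sum>k=1..n. ((1 / real k) * (\<Sum>j=1..k. astar p \<alpha> j)) powr p)" if "alpha_eq p n \<alpha>" for \<alpha>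
      using astar_almost_extremal[OF p n that] by (simp add: Q_def c3_def)
  qed (use c3 c4 lower upper sharp in auto)
qed

end
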